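(* Let $k$ be a field, $A$ a (finite dimensional) Frobenius $k$-algebra, $\varphi\colon A\to k$ a Frobenius homomorphism and $\rho\colon A\to A$ the Nakayama automorphism of $A$ with respect to $\varphi$. Assume that $\rho$ has finite order $m=\operatorname{ord}_\rho$, that $k$ has a primitive $m$-th root of unity $w$, and that the $\mathbb Z/m\mathbb Z$-grading $A=A_0\oplus\cdots\oplus A_{m-1}$, $A_i=\{a\in A:\rho(a)=w^ia\}$, is strongly graded. If $\operatorname{HH}^2(A_0)=0$, then $A$ is rigid.
   Context: Let $A$ be a finite dimensional $k$-algebra and let $DA=\operatorname{Hom}_k(A,k)$ with its usual $A$-bimodule structure: $(x f)(a)=f(ax)$ and $(f x)(a)=f(xa)$ for $f\in DA$, $x,a\in A$. $A$ is a Frobenius algebra if there is a linear form $\varphi\colon A\to k$ (a Frobenius homomorphism) such that $A\to DA$, $x\mapsto x\varphi$, is an isomorphism of left $A$-modules; equivalently $x\mapsto\varphi x$ is an isomorphism of right $A$-modules. The Nakayama automorphism of $A$ with respect to $\varphi$ is the algebra automorphism $\rho$ of $A$ determined by $x\varphi=\varphi\rho(x)$ for all $x\in A$. It has order $m\in\mathbb N$ (written $\operatorname{ord}_\rho=m$) if $\rho^m=\mathrm{id}_A$ and $\rho^r\neq\mathrm{id}_A$ for all $1\le r<m$. If $\rho$ has finite order $m$ and $w\in k$ is a primitive $m$-th root of unity, then $A=A_0\oplus\cdots\oplus A_{m-1}$ is a $\mathbb Z/m\mathbb Z$-graded algebra, where $A_i=\{a\in A:\rho(a)=w^ia\}$.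 It is strongly $\mathbb Z/m\mathbb Z$-graded if $A_iA_j=A_{i+j}$ for all $i,j$, with $i+j$ the sum in $\mathbb Z/m\mathbb Z$. $\operatorname{HH}^2(A_0)$ is the second Hochschild cohomology of the algebra $A_0$ with coefficients in $A_0$. Rigid is meant in the sense of Gerstenhaber's deformation theory: every formal deformation of $A$, i.e. every associative $k[[t]]$-bilinear multiplication on $A[[t]]$ reducing to that of $A$ modulo $t$, is equivalent to the trivial one, via a $k[[t]]$-linear automorphism of $A[[t]]$ that reduces to the identity modulo $t$. *)

theory Defs
  imports Complex_Main "HOL-Computational_Algebra.Formal_Power_Series"
begin

section \<open>Finite dimensional algebras\<close>

text \<open>
  The algebra is the whole type \<open>'a\<close>. The unit \<open>e\<close> is a parameter instead of
  the constant \<open>1\<close> of class \<open>ring_1\<close>, because that class excludes the zero algebra.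
\<close>

locale fd_algebra = vector_space scale
  for scale :: "'k::field \<Rightarrow> 'a::ring \<Rightarrow> 'a" +
  fixes e :: 'a
  assumes unit_left: "e * x = x"
    and unit_right: "x * e = x"
    and scale_mult_left: "scale c x * y = scale c (x * y)"
    and scale_mult_right: "x * scale c y = scale c (x * y)"
    and finite_dim: "\<exists>B. finite B \<and> module.span scale B = UNIV"

definition algebra_automorphism :: "('k::field \<Rightarrow> 'a::ring \<Rightarrow> 'a) \<Rightarrow> 'a \<Rightarrow> ('a \<Rightarrow> 'a) \<Rightarrow> bool" where
  "algebra_automorphism scale e h \<longleftrightarrow>
     Vector_Spaces.linear scale scale h \<and> bij h \<and>
     (\<forall>x y. h (x * y) = h x * h y) \<and> h e = e"


section \<open>Frobenius homomorphisms and Nakayama automorphisms\<close>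

definition dual_space :: "('k::field \<Rightarrow> 'a::ring \<Rightarrow> 'a) \<Rightarrow> ('a \<Rightarrow> 'k) set" where
  "dual_space scale = {f. Vector_Spaces.linear scale (*) f}"

definition dual_lact :: "'a::ring \<Rightarrow> ('a \<Rightarrow> 'k) \<Rightarrow> 'a \<Rightarrow> 'k" where
  "dual_lact x f = (\<lambda>a. f (a * x))"

definition dual_ract :: "('a::ring \<Rightarrow> 'k) \<Rightarrow> 'a \<Rightarrow> 'a \<Rightarrow> 'k" where
  "dual_ract f x = (\<lambda>a. f (x * a))"

definition left_module_iso_dual :: "('k::field \<Rightarrow> 'a::ring \<Rightarrow> 'a) \<Rightarrow> ('a \<Rightarrow> 'a \<Rightarrow> 'k) \<Rightarrow> bool" where
  "left_module_iso_dual scale h \<longleftrightarrow>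
     bij_betw h UNIV (dual_space scale) \<and>
     (\<forall>x y. h (x + y) = (\<lambda>a. h x a + h y a)) \<and>
     (\<forall>x y. h (x * y) = dual_lact x (h y))"

definition frobenius_homomorphism :: "('k::field \<Rightarrow> 'a::ring \<Rightarrow> 'a) \<Rightarrow> ('a \<Rightarrow> 'k) \<Rightarrow> bool" where
  "frobenius_homomorphism scale \<phi> \<longleftrightarrow>
     \<phi> \<in> dual_space scale \<and> left_module_iso_dual scale (\<lambda>x. dual_lact x \<phi>)"

definition nakayama_automorphism ::
    "('k::field \<Rightarrow> 'a::ring \<Rightarrow> 'a) \<Rightarrow> 'a \<Rightarrow> ('a \<Rightarrow> 'k) \<Rightarrow> ('a \<Rightarrow> 'a) \<Rightarrow> bool" where
  "nakayama_automorphism scale e \<phi> \<rho> \<longleftrightarrow>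
     algebra_automorphism scale e \<rho> \<and> (\<forall>x. dual_lact x \<phi> = dual_ract \<phi> (\<rho> x))"

definition has_order :: "('a \<Rightarrow> 'a) \<Rightarrow> nat \<Rightarrow> bool" where
  "has_order \<rho> m \<longleftrightarrow> 1 \<le> m \<and> \<rho> ^^ m = id \<and> (\<forall>r. 1 \<le> r \<and> r < m \<longrightarrow> \<rho> ^^ r \<noteq> id)"


section \<open>The eigenspace grading\<close>

definition primitive_root_of_unity :: "nat \<Rightarrow> 'k::field \<Rightarrow> bool" where
  "primitive_root_of_unity m w \<longleftrightarrow> 1 \<le> m \<and> w ^ m = 1 \<and> (\<forall>r. 1 \<le> r \<and> r < m \<longrightarrow> w ^ r \<noteq> 1)"

definition eigen_component ::
    "('k::field \<Rightarrow> 'a::ring \<Rightarrow> 'a) \<Rightarrow> ('a \<Rightarrow> 'a) \<Rightarrow> 'k \<Rightarrow> nat \<Rightarrow> 'a set" where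
  "eigen_component scale \<rho> w i = {a. \<rho> a = scale (w ^ i) a}"

text \<open>
  The product of two subspaces is the span of the products of their elements; \<open>\<int>/m\<int>\<close> is
  represented by the residues \<open>0, \<dots>, m - 1\<close>.
\<close>

definition subspace_prod :: "('k::field \<Rightarrow> 'a::ring \<Rightarrow> 'a) \<Rightarrow> 'a set \<Rightarrow> 'a set \<Rightarrow> 'a set" where
  "subspace_prod scale U V = module.span scale {x * y | x y. x \<in> U \<and> y \<in> V}"

definition strongly_graded :: "('k::field \<Rightarrow> 'a::ring \<Rightarrow> 'a) \<Rightarrow> nat \<Rightarrow> (nat \<Rightarrow> 'a set) \<Rightarrow> bool" where
  "strongly_graded scale m G \<longleftrightarrow>
     (\<forall>i<m. \<forall>j<m. subspace_prod scale (G i) (G j) = G ((i + j) mod m))"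


section \<open>Second Hochschild cohomology\<close>

text \<open>
  Cochains are those of the Hochschild complex of a subalgebra \<open>S\<close> with coefficients in \<open>S\<close>.
  A map on \<open>S\<close> is represented by the total function extending it by zero, so that distinct
  functions represent distinct cochains.
\<close>

definition linear_on :: "('k::field \<Rightarrow> 'a::ring \<Rightarrow> 'a) \<Rightarrow> 'a set \<Rightarrow> ('a \<Rightarrow> 'a) \<Rightarrow> bool" where
  "linear_on scale S g \<longleftrightarrow>
     (\<forall>x\<in>S. \<forall>y\<in>S. g (x + y) = g x + g y) \<and> (\<forall>c. \<forall>x\<in>S. g (scale c x) = scale c (g x))"

definition cochains1 :: "('k::field \<Rightarrow> 'a::ring \<Rightarrow> 'a) \<Rightarrow> 'a set \<Rightarrow> ('a \<Rightarrow> 'a) set" where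
  "cochains1 scale S =
     {g. (\<forall>x\<in>S. g x \<in> S) \<and> linear_on scale S g \<and> (\<forall>x. x \<notin> S \<longrightarrow> g x = 0)}"

definition cochains2 :: "('k::field \<Rightarrow> 'a::ring \<Rightarrow> 'a) \<Rightarrow> 'a set \<Rightarrow> ('a \<Rightarrow> 'a \<Rightarrow> 'a) set" where
  "cochains2 scale S =
     {f. (\<forall>x\<in>S. \<forall>y\<in>S. f x y \<in> S) \<and>
         (\<forall>x\<in>S. linear_on scale S (f x)) \<and> (\<forall>y\<in>S. linear_on scale S (\<lambda>x. f x y)) \<and>
         (\<forall>x y. x \<notin> S \<or> y \<notin> S \<longrightarrow> f x y = 0)}"

definition hochschild_d1 :: "'a::ring set \<Rightarrow> ('a \<Rightarrow> 'a) \<Rightarrow> 'a \<Rightarrow> 'a \<Rightarrow> 'a" where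
  "hochschild_d1 S g =
     (\<lambda>x y. if x \<in> S \<and> y \<in> S then x * g y - g (x * y) + g x * y else 0)"

definition hochschild_d2 :: "'a::ring set \<Rightarrow> ('a \<Rightarrow> 'a \<Rightarrow> 'a) \<Rightarrow> 'a \<Rightarrow> 'a \<Rightarrow> 'a \<Rightarrow> 'a" where
  "hochschild_d2 S f =
     (\<lambda>x y z. if x \<in> S \<and> y \<in> S \<and> z \<in> S
        then x * f y z - f (x * y) z + f x (y * z) - f x y * z else 0)"

definition cocycles2 :: "('k::field \<Rightarrow> 'a::ring \<Rightarrow> 'a) \<Rightarrow> 'a set \<Rightarrow> ('a \<Rightarrow> 'a \<Rightarrow> 'a) set" where
  "cocycles2 scale S = {f \<in> cochains2 scale S. hochschild_d2 S f = (\<lambda>x y z. 0)}"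

definition coboundaries2 :: "('k::field \<Rightarrow> 'a::ring \<Rightarrow> 'a) \<Rightarrow> 'a set \<Rightarrow> ('a \<Rightarrow> 'a \<Rightarrow> 'a) set" where
  "coboundaries2 scale S = hochschild_d1 S ` cochains1 scale S"

definition HH2 :: "('k::field \<Rightarrow> 'a::ring \<Rightarrow> 'a) \<Rightarrow> 'a set \<Rightarrow> ('a \<Rightarrow> 'a \<Rightarrow> 'a) set set" where
  "HH2 scale S = cocycles2 scale S //
     {(f, g). f \<in> cocycles2 scale S \<and> g \<in> cocycles2 scale S \<and>
              (\<lambda>x y. f x y - g x y) \<in> coboundaries2 scale S}"

text \<open>The zero element of the quotient is the class of the coboundaries.\<close>

definition HH2_vanishes :: "('k::field \<Rightarrow> 'a::ring \<Rightarrow> 'a) \<Rightarrow> 'a set \<Rightarrow> bool" where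
  "HH2_vanishes scale S \<longleftrightarrow> HH2 scale S = {coboundaries2 scale S}"


section \<open>Formal deformations\<close>

definition fps_scale ::
    "('k::field \<Rightarrow> 'a::ring \<Rightarrow> 'a) \<Rightarrow> 'k fps \<Rightarrow> 'a fps \<Rightarrow> 'a fps" where
  "fps_scale scale c f = Abs_fps (\<lambda>n. \<Sum>i=0..n. scale (fps_nth c i) (fps_nth f (n - i)))"

lemma module_fps_scale:
  assumes "vector_space scale"
  shows "module (fps_scale scale)"
proof -
  interpret vector_space scale by fact
  show ?thesis
  proof
    fix c d :: "'a fps" and f g :: "'b fps"
    show "fps_scale scale c (f + g) = fps_scale scale c f + fps_scale scale c g"
      by (simp add: fps_eq_iff fps_scale_def scale_right_distrib sum.distrib)
    show "fps_scale scale (c + d) f = fps_scale scale c f + fps_scale scale d f"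
      by (simp add: fps_eq_iff fps_scale_def scale_left_distrib sum.distrib)
    show "fps_scale scale 1 f = f"
    proof (rule fps_ext)
      fix n
      have "fps_nth (fps_scale scale 1 f) n = (\<Sum>i=0..n. if i = 0 then fps_nth f n else 0)"
        unfolding fps_scale_def fps_nth_Abs_fps by (rule sum.cong) auto
      then show "fps_nth (fps_scale scale 1 f) n = fps_nth f n" by simp
    qed
    show "fps_scale scale c (fps_scale scale d f) = fps_scale scale (c * d) f"
    proof (rule fps_ext)
      fix n
      have "fps_nth (fps_scale scale c (fps_scale scale d f)) n =
          (\<Sum>j=0..n. \<Sum>i=0..n - j. scale (fps_nth c j * fps_nth d i) (fps_nth f (n - j - i)))"
        by (simp add: fps_scale_def scale_sum_right)
      also have "\<dots> = (\<Sum>j=0..n. \<Sum>i=0..j. scale (fps_nth c i * fps_nth d (j - i)) (fps_nth f (n - j)))"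
        using fps_mult_assoc_lemma[of "\<lambda>i j k. scale (fps_nth c i * fps_nth d j) (fps_nth f k)" n]
        by simp
      also have "\<dots> = fps_nth (fps_scale scale (c * d) f) n"
        by (simp add: fps_scale_def fps_mult_nth scale_sum_left)
      finally show "fps_nth (fps_scale scale c (fps_scale scale d f)) n =
          fps_nth (fps_scale scale (c * d) f) n" .
    qed
  qed
qed

text \<open>
  Reduction modulo \<open>t\<close> is the constant coefficient, and the multiplication of \<^typ>\<open>'a fps\<close>
  is the trivial deformation.
\<close>

definition formal_deformation ::
    "('k::field \<Rightarrow> 'a::ring \<Rightarrow> 'a) \<Rightarrow> ('a fps \<Rightarrow> 'a fps \<Rightarrow> 'a fps) \<Rightarrow> bool" where
  "formal_deformation scale \<mu> \<longleftrightarrow>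
     (\<forall>f. module_hom (fps_scale scale) (fps_scale scale) (\<mu> f)) \<and>
     (\<forall>g. module_hom (fps_scale scale) (fps_scale scale) (\<lambda>f. \<mu> f g)) \<and>
     (\<forall>f g h. \<mu> (\<mu> f g) h = \<mu> f (\<mu> g h)) \<and>
     (\<forall>f g. fps_nth (\<mu> f g) 0 = fps_nth f 0 * fps_nth g 0)"

definition equivalent_deformations ::
    "('k::field \<Rightarrow> 'a::ring \<Rightarrow> 'a) \<Rightarrow> ('a fps \<Rightarrow> 'a fps \<Rightarrow> 'a fps) \<Rightarrow>
     ('a fps \<Rightarrow> 'a fps \<Rightarrow> 'a fps) \<Rightarrow> bool" where
  "equivalent_deformations scale \<mu> \<nu> \<longleftrightarrow>
     (\<exists>\<Phi>. module_hom (fps_scale scale) (fps_scale scale) \<Phi> \<and> bij \<Phi> \<and>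
          (\<forall>f. fps_nth (\<Phi> f) 0 = fps_nth f 0) \<and>
          (\<forall>f g. \<Phi> (\<mu> f g) = \<nu> (\<Phi> f) (\<Phi> g)))"

definition rigid :: "('k::field \<Rightarrow> 'a::ring \<Rightarrow> 'a) \<Rightarrow> bool" where
  "rigid scale \<longleftrightarrow>
     (\<forall>\<mu>. formal_deformation scale \<mu> \<longrightarrow> equivalent_deformations scale \<mu> (*))"

end

theory Submission
  imports Defs "HOL-Computational_Algebra.Polynomial"
begin

text \<open>
  The proof shows that every Hochschild 2-cocycle of \<open>A\<close> is a coboundary and then applies
  Gerstenhaber's theorem that the vanishing of \<open>HH\<^sup>2(A)\<close> makes \<open>A\<close> rigid
  (\<open>rigid_if_cocycles_coboundaries\<close>).

  The Frobenius form identifies Hochschild cochains of \<open>A\<close> with multilinear forms on which the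
  cyclic rotation, corrected by \<open>\<rho>\<close>, acts. Connes' operator on these forms is a homotopy showing
  that \<open>\<rho>\<close> acts trivially on \<open>HH\<^sup>2(A)\<close> (\<open>twist_cohomologous\<close>). A primitive \<open>m\<close>-th root of unity exists
  only if \<open>m\<close> is invertible in \<open>k\<close>, so averaging over the powers of \<open>\<rho>\<close> replaces a cocycle by a
  cohomologous one that commutes with \<open>\<rho>\<close> (\<open>invariant_representative\<close>). Such a cocycle maps
  \<open>A\<^sub>0 \<times> A\<^sub>0\<close> into \<open>A\<^sub>0\<close>, which brings the hypothesis on \<open>HH\<^sup>2(A\<^sub>0)\<close> into play.

  The step from \<open>A\<^sub>0\<close> to \<open>A\<close> uses that a strongly \<open>\<int>/m\<close>-graded algebra with \<open>m\<close> invertible is a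
  separable Frobenius extension of its part of degree zero
  (\<open>strongly_graded_separable_frobenius\<close>). For such an extension restriction to the smaller algebra
  is injective on cohomology (\<open>coboundary_if_HH2_vanishes\<close>): the cocycle is first made zero on
  \<open>A\<^sub>0 \<times> A\<^sub>0\<close>, then on \<open>A\<^sub>0 \<times> A\<close> because \<open>A\<close> is a projective left \<open>A\<^sub>0\<close>-module, and what remains is a
  coboundary by contraction with the separability idempotent.
\<close>

section \<open>Hochschild 2-cocycles of the whole algebra\<close>

lemma additive_linear_on: "linear_on scale UNIV g \<Longrightarrow> additive g"
  by (simp add: linear_on_def additive_def)

context fd_algebra
begin

abbreviation lin :: "('a \<Rightarrow> 'a) \<Rightarrow> bool" where
  "lin g \<equiv> linear_on scale UNIV g"

lemma linI:
  assumes "\<And>x y. g (x + y) = g x + g y" and "\<And>c x. g (scale c x) = scale c (g x)"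
  shows "lin g"
  using assms by (simp add: linear_on_def)

lemma lin_add: "lin g \<Longrightarrow> g (x + y) = g x + g y"
  and lin_scale: "lin g \<Longrightarrow> g (scale c x) = scale c (g x)"
  by (simp_all add: linear_on_def)

lemma lin_zero: "lin g \<Longrightarrow> g 0 = 0"
  and lin_sum: "lin g \<Longrightarrow> g (sum h T) = (\<Sum>t\<in>T. g (h t))"
  by (rule additive.zero additive.sum, erule additive_linear_on)+

lemma cocycles2_UNIV_iff:
  "f \<in> cocycles2 scale UNIV \<longleftrightarrow>
     (\<forall>x. lin (f x)) \<and> (\<forall>y. lin (\<lambda>x. f x y)) \<and>
     (\<forall>x y z. x * f y z + f x (y * z) = f (x * y) z + f x y * z)"
proof -
  have "x * f y z - f (x * y) z + f x (y * z) - f x y * z = 0 \<longleftrightarrow>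
      x * f y z + f x (y * z) = f (x * y) z + f x y * z" for x y z
    by (auto simp: algebra_simps)
  then show ?thesis
    by (simp add: cocycles2_def cochains2_def hochschild_d2_def fun_eq_iff)
qed

lemma cocycle_lin_right: "f \<in> cocycles2 scale UNIV \<Longrightarrow> lin (f x)"
  and cocycle_lin_left: "f \<in> cocycles2 scale UNIV \<Longrightarrow> lin (\<lambda>x. f x y)"
  and cocycle_eq: "f \<in> cocycles2 scale UNIV \<Longrightarrow>
      x * f y z + f x (y * z) = f (x * y) z + f x y * z"
  by (simp_all add: cocycles2_UNIV_iff)

lemma coboundaries2_UNIV_iff:
  "f \<in> coboundaries2 scale UNIV \<longleftrightarrow>
     (\<exists>g. lin g \<and> (\<forall>x y. f x y = x * g y - g (x * y) + g x * y))"
  by (auto simp: coboundaries2_def cochains1_def hochschild_d1_def fun_eq_iff image_iff)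

lemma coboundaryI:
  assumes "lin g" and "\<And>x y. f x y = x * g y - g (x * y) + g x * y"
  shows "f \<in> coboundaries2 scale UNIV"
  using assms by (auto simp: coboundaries2_UNIV_iff)

lemma zero_coboundary: "(\<lambda>x y. 0) \<in> coboundaries2 scale UNIV"
  by (rule coboundaryI[of "\<lambda>x. 0"]) (auto intro: linI)

lemma coboundary_add:
  assumes "f \<in> coboundaries2 scale UNIV" and "h \<in> coboundaries2 scale UNIV"
  shows "(\<lambda>x y. f x y + h x y) \<in> coboundaries2 scale UNIV"
proof -
  obtain g k where "lin g" "\<And>x y. f x y = x * g y - g (x * y) + g x * y"
    and "lin k" "\<And>x y. h x y = x * k y - k (x * y) + k x * y"
    using assms by (auto simp: coboundaries2_UNIV_iff)
  then show ?thesis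
    by (intro coboundaryI[of "\<lambda>x. g x + k x"] linI)
       (simp_all add: lin_add lin_scale scale_right_distrib algebra_simps)
qed

lemma coboundary_scale:
  assumes "f \<in> coboundaries2 scale UNIV"
  shows "(\<lambda>x y. scale c (f x y)) \<in> coboundaries2 scale UNIV"
proof -
  obtain g where "lin g" "\<And>x y. f x y = x * g y - g (x * y) + g x * y"
    using assms by (auto simp: coboundaries2_UNIV_iff)
  then show ?thesis
    by (intro coboundaryI[of "\<lambda>x. scale c (g x)"] linI)
       (simp_all add: lin_add lin_scale scale_right_distrib scale_right_diff_distrib
          scale_mult_left scale_mult_right mult.commute)
qed

lemma coboundary_sum:
  assumes "\<And>i. i \<in> I \<Longrightarrow> f i \<in> coboundaries2 scale UNIV"
  shows "(\<lambda>x y. \<Sum>i\<in>I. f i x y) \<in> coboundaries2 scale UNIV"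
  using assms
  by (induction I rule: infinite_finite_induct)
     (simp_all add: zero_coboundary coboundary_add)

lemma cocycle_add:
  assumes "f \<in> cocycles2 scale UNIV" and "h \<in> cocycles2 scale UNIV"
  shows "(\<lambda>x y. f x y + h x y) \<in> cocycles2 scale UNIV"
proof -
  have "x * (f y z + h y z) + (f x (y * z) + h x (y * z)) =
      (x * f y z + f x (y * z)) + (x * h y z + h x (y * z))" for x y z
    by (simp add: algebra_simps)
  also have "\<dots> x y z = f (x * y) z + h (x * y) z + (f x y + h x y) * z" for x y z
    by (simp add: cocycle_eq[OF assms(1)] cocycle_eq[OF assms(2)] algebra_simps)
  finally show ?thesis
    using assms
    by (auto simp: cocycles2_UNIV_iff linear_on_def scale_right_distrib ac_simps)
qed

lemma cocycle_scale:
  assumes "f \<in> cocycles2 scale UNIV"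
  shows "(\<lambda>x y. scale c (f x y)) \<in> cocycles2 scale UNIV"
  using assms
  by (auto simp: cocycles2_UNIV_iff linear_on_def scale_right_distrib mult.commute
      scale_mult_left scale_mult_right simp flip: scale_right_distrib)

lemma coboundary_cocycle:
  assumes "f \<in> coboundaries2 scale UNIV"
  shows "f \<in> cocycles2 scale UNIV"
proof -
  obtain g where g: "lin g" and "\<And>x y. f x y = x * g y - g (x * y) + g x * y"
    using assms by (auto simp: coboundaries2_UNIV_iff)
  then have f: "f = (\<lambda>x y. x * g y - g (x * y) + g x * y)"
    by (simp add: fun_eq_iff)
  show ?thesis
    by (auto simp: f cocycles2_UNIV_iff lin_add[OF g] lin_scale[OF g] scale_right_distrib
        scale_right_diff_distrib scale_mult_left scale_mult_right algebra_simps intro!: linI)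
qed

lemma cocycle_diff:
  assumes "f \<in> cocycles2 scale UNIV" and "h \<in> cocycles2 scale UNIV"
  shows "(\<lambda>x y. f x y - h x y) \<in> cocycles2 scale UNIV"
  using cocycle_add[OF assms(1) cocycle_scale[OF assms(2), of "-1"]] by simp

lemma cohomologous_coboundary:
  assumes "(\<lambda>x y. f x y - h x y) \<in> coboundaries2 scale UNIV"
    and "h \<in> coboundaries2 scale UNIV"
  shows "f \<in> coboundaries2 scale UNIV"
  using coboundary_add[OF assms] by simp

lemma HH2_vanishesD:
  assumes "HH2_vanishes scale S" and "0 \<in> S" and "f \<in> cocycles2 scale S"
  shows "f \<in> coboundaries2 scale S"
proof -
  let ?R = "{(f, g). f \<in> cocycles2 scale S \<and> g \<in> cocycles2 scale S \<and>
              (\<lambda>x y. f x y - g x y) \<in> coboundaries2 scale S}"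
  have "?R `` {f} \<in> {coboundaries2 scale S}"
    using assms(1,3) unfolding HH2_vanishes_def HH2_def by (metis (lifting) quotientI)
  moreover have "(\<lambda>x y. 0) \<in> coboundaries2 scale S"
    unfolding coboundaries2_def
    using assms(2)
    by (intro image_eqI[of _ _ "\<lambda>x. 0"])
       (auto simp: hochschild_d1_def cochains1_def linear_on_def fun_eq_iff)
  then have "f \<in> ?R `` {f}" using assms(3) by simp
  ultimately show ?thesis by simp
qed

end

section \<open>Vanishing second cohomology implies rigidity\<close>

context fd_algebra
begin

unbundle fps_syntax

abbreviation power_series_linear :: "('a fps \<Rightarrow> 'a fps) \<Rightarrow> bool" where
  "power_series_linear L \<equiv> module_hom (fps_scale scale) (fps_scale scale) L"

lemma power_series_linearI:
  assumes "\<And>f g. L (f + g) = L f + L g"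
    and "\<And>c f. L (fps_scale scale c f) = fps_scale scale c (L f)"
  shows "power_series_linear L"
  using assms module_fps_scale[OF vector_space_axioms] by (simp add: module_hom_iff)

lemma fps_scale_const_nth: "fps_scale scale (fps_const c) f $ n = scale c (f $ n)"
proof -
  have "fps_scale scale (fps_const c) f $ n = (\<Sum>i=0..n. if i = 0 then scale c (f $ n) else 0)"
    unfolding fps_scale_def fps_nth_Abs_fps by (rule sum.cong) auto
  then show ?thesis by simp
qed

lemma fps_scale_X_nth_0: "fps_scale scale fps_X f $ 0 = 0"
  by (simp add: fps_scale_def)

lemma fps_scale_X_nth_Suc: "fps_scale scale fps_X f $ Suc n = f $ n"
proof -
  have "fps_scale scale fps_X f $ Suc n = (\<Sum>i=0..Suc n. if i = 1 then f $ n else 0)"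
    unfolding fps_scale_def fps_nth_Abs_fps by (rule sum.cong) auto
  then show ?thesis by simp
qed

lemma fps_eq_const_plus_X:
  fixes f :: "'a fps"
  shows "f = fps_const (f $ 0) + fps_scale scale fps_X (fps_shift 1 f)" (is "_ = ?r")
proof (rule fps_ext)
  fix n show "f $ n = ?r $ n"
    by (cases n) (simp_all add: fps_scale_X_nth_0 fps_scale_X_nth_Suc)
qed

lemma power_series_linear_nth:
  assumes "power_series_linear L"
  shows "L f $ 0 = L (fps_const (f $ 0)) $ 0"
    and "L f $ Suc n = L (fps_const (f $ 0)) $ Suc n + L (fps_shift 1 f) $ n"
proof -
  have "L f = L (fps_const (f $ 0)) + fps_scale scale fps_X (L (fps_shift 1 f))"
    using arg_cong[OF fps_eq_const_plus_X, of L f]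
    by (simp add: module_hom.add[OF assms] module_hom.scale[OF assms])
  then show "L f $ 0 = L (fps_const (f $ 0)) $ 0"
    and "L f $ Suc n = L (fps_const (f $ 0)) $ Suc n + L (fps_shift 1 f) $ n"
    by (simp_all add: fps_scale_X_nth_0 fps_scale_X_nth_Suc)
qed

text \<open>
  Writing \<open>f = f\<^sub>0 + t f'\<close> moves the question about the coefficient of \<open>t\<^sup>k\<^sup>+\<^sup>1\<close> of \<open>L f\<close> to that of
  \<open>t\<^sup>k\<close> of \<open>L f'\<close>.
\<close>

lemma power_series_linear_order:
  assumes L: "power_series_linear L" and const: "\<And>a k. k < n \<Longrightarrow> L (fps_const a) $ k = 0"
  shows "k < n \<Longrightarrow> L f $ k = 0" and "L f $ n = L (fps_const (f $ 0)) $ n"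
proof -
  show low: "L f $ k = 0" if "k < n" for k f
    using that
  proof (induction k arbitrary: f)
    case 0 then show ?case
      using power_series_linear_nth(1)[OF L, of f] const by simp
  next
    case (Suc k) then show ?case
      using power_series_linear_nth(2)[OF L, of f k] const by simp
  qed
  show "L f $ n = L (fps_const (f $ 0)) $ n"
    using power_series_linear_nth[OF L, of f] low by (cases n) auto
qed

text \<open>
  A \<open>k[[t]]\<close>-linear map is automatically \<open>t\<close>-adically continuous, which lets the values on
  constant series control the whole map, one coefficient at a time and without choosing a basis.
\<close>

lemma power_series_bilinear_order:
  assumes right: "\<And>f. power_series_linear (D f)" and left: "\<And>h. power_series_linear (\<lambda>f. D f h)"
    and const: "\<And>a b k. k < n \<Longrightarrow> D (fps_const a) (fps_const b) $ k = 0"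
  shows "k < n \<Longrightarrow> D f h $ k = 0"
    and "D f h $ n = D (fps_const (f $ 0)) (fps_const (h $ 0)) $ n"
proof -
  have *: "D (fps_const a) h $ k = 0" if "k < n" for a h k
    using power_series_linear_order(1)[OF right const that] .
  show "k < n \<Longrightarrow> D f h $ k = 0"
    using power_series_linear_order(1)[OF left *] .
  have "D f h $ n = D (fps_const (f $ 0)) h $ n"
    using power_series_linear_order(2)[OF left *] .
  also have "\<dots> = D (fps_const (f $ 0)) (fps_const (h $ 0)) $ n"
    using power_series_linear_order(2)[OF right const] .
  finally show "D f h $ n = D (fps_const (f $ 0)) (fps_const (h $ 0)) $ n" .
qed

lemma fps_scale_mult_left: "fps_scale scale c f * g = fps_scale scale c (f * g)"
proof (rule fps_ext)
  fix n
  show "(fps_scale scale c f * g) $ n = fps_scale scale c (f * g) $ n"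
    using fps_mult_assoc_lemma[of "\<lambda>i j k. scale (c $ i) (f $ j * g $ k)" n n]
    by (simp add: fps_scale_def fps_mult_nth sum_distrib_right scale_sum_right scale_mult_left)
qed

lemma sum_triangle_swap:
  fixes h :: "nat \<Rightarrow> nat \<Rightarrow> 'b::comm_monoid_add"
  shows "(\<Sum>i=0..n. \<Sum>j=0..n-i. h i j) = (\<Sum>j=0..n. \<Sum>i=0..n-j. h i j)"
proof -
  have "(\<Sum>i=0..n. \<Sum>j=0..n-i. h i j) = (\<Sum>i=0..n. \<Sum>j | j \<in> {0..n} \<and> i + j \<le> n. h i j)"
    by (intro sum.cong) auto
  also have "\<dots> = (\<Sum>j=0..n. \<Sum>i | i \<in> {0..n} \<and> i + j \<le> n. h i j)"
    by (rule sum.swap_restrict) auto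
  also have "\<dots> = (\<Sum>j=0..n. \<Sum>i=0..n-j. h i j)"
    by (intro sum.cong) auto
  finally show ?thesis .
qed

lemma fps_scale_mult_right: "f * fps_scale scale c g = fps_scale scale c (f * g)"
proof (rule fps_ext)
  fix n
  have "(f * fps_scale scale c g) $ n = (\<Sum>i=0..n. \<Sum>j=0..n-i. scale (c $ j) (f $ i * g $ (n-i-j)))"
    by (simp add: fps_scale_def fps_mult_nth sum_distrib_left scale_mult_right)
  also have "\<dots> = (\<Sum>j=0..n. \<Sum>i=0..n-j. scale (c $ j) (f $ i * g $ (n-i-j)))"
    by (rule sum_triangle_swap)
  also have "\<dots> = fps_scale scale c (f * g) $ n"
    by (simp add: fps_scale_def fps_mult_nth scale_sum_right add.commute)
  finally show "(f * fps_scale scale c g) $ n = fps_scale scale c (f * g) $ n" .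
qed

text \<open>The map \<open>\<Sum>\<^sub>i t\<^sup>i g\<^sub>i\<close> of \<open>A[[t]]\<close>.\<close>

definition series_map :: "(nat \<Rightarrow> 'a \<Rightarrow> 'a) \<Rightarrow> 'a fps \<Rightarrow> 'a fps" where
  "series_map g f = Abs_fps (\<lambda>n. \<Sum>i=0..n. g i (f $ (n - i)))"

lemma series_map_nth: "series_map g f $ n = (\<Sum>i=0..n. g i (f $ (n - i)))"
  by (simp add: series_map_def)

lemma series_map_nth_cong:
  "(\<And>i. i \<le> n \<Longrightarrow> g i = g' i) \<Longrightarrow> series_map g f $ n = series_map g' f $ n"
  by (simp add: series_map_nth)

lemma power_series_linear_series_map:
  assumes "\<And>i. lin (g i)"
  shows "power_series_linear (series_map g)"
proof (rule power_series_linearI)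
  fix f h :: "'a fps" and c :: "'k fps"
  show "series_map g (f + h) = series_map g f + series_map g h"
    by (rule fps_ext) (simp add: series_map_nth lin_add[OF assms] sum.distrib)
  show "series_map g (fps_scale scale c f) = fps_scale scale c (series_map g f)"
  proof (rule fps_ext)
    fix n
    have "series_map g (fps_scale scale c f) $ n =
        (\<Sum>i=0..n. \<Sum>j=0..n-i. scale (c $ j) (g i (f $ (n-i-j))))"
      by (simp add: series_map_nth fps_scale_def lin_sum[OF assms] lin_scale[OF assms])
    also have "\<dots> = (\<Sum>j=0..n. \<Sum>i=0..n-j. scale (c $ j) (g i (f $ (n-i-j))))"
      by (rule sum_triangle_swap)
    also have "\<dots> = fps_scale scale c (series_map g f) $ n"
      by (simp add: series_map_nth fps_scale_def scale_sum_right add.commute)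
    finally show "series_map g (fps_scale scale c f) $ n = fps_scale scale c (series_map g f) $ n" .
  qed
qed

text \<open>
  The equation \<open>\<Sum>\<^sub>i t\<^sup>i g\<^sub>i (f) = y\<close> determines the coefficients of \<open>f\<close> one after the other.
\<close>

lemma bij_series_map:
  assumes "g 0 = id"
  shows "bij (series_map g)"
proof (rule bijI)
  have nth: "series_map g f $ n = f $ n + (\<Sum>i=1..n. g i (f $ (n - i)))" for f n
    by (simp add: series_map_nth sum.atLeast_Suc_atMost assms)
  show "inj (series_map g)"
  proof (rule injI)
    fix f h assume eq: "series_map g f = series_map g h"
    show "f = h"
    proof (rule fps_ext)
      fix n show "f $ n = h $ n"
      proof (induction n rule: less_induct)
        case (less n)
        then have "(\<Sum>i=1..n. g i (f $ (n - i))) = (\<Sum>i=1..n. g i (h $ (n - i)))"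
          by (intro sum.cong) auto
        moreover have "series_map g f $ n = series_map g h $ n"
          by (simp add: eq)
        ultimately show ?case by (simp add: nth)
      qed
    qed
  qed
  show "surj (series_map g)"
  unfolding surj_def
  proof
    fix y
    have "\<exists>f. \<forall>n. f n = y $ n - (\<Sum>i=1..n. g i (f (n - i)))"
    proof (rule dependent_wf_choice[OF wf_less_than])
      fix f f' :: "nat \<Rightarrow> 'a" and n r
      assume "\<And>k. (k, n) \<in> less_than \<Longrightarrow> f k = f' k"
      then have "(\<Sum>i=1..n. g i (f (n - i))) = (\<Sum>i=1..n. g i (f' (n - i)))"
        by (intro sum.cong) auto
      then show "(r = y $ n - (\<Sum>i=1..n. g i (f (n - i)))) =
          (r = y $ n - (\<Sum>i=1..n. g i (f' (n - i))))"
        by simp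
    qed blast
    then obtain f where f: "\<And>n. f n = y $ n - (\<Sum>i=1..n. g i (f (n - i)))" by blast
    have "series_map g (Abs_fps f) = y"
      by (rule fps_ext) (simp add: nth, subst f, simp)
    then show "\<exists>x. y = series_map g x" by metis
  qed
qed

lemma mult_nth_order_left:
  fixes E F :: "'a fps"
  assumes "\<And>k. k < n \<Longrightarrow> E $ k = 0"
  shows "(E * F) $ n = E $ n * F $ 0"
proof -
  have "(E * F) $ n = (\<Sum>i=0..n. if i = n then E $ n * F $ 0 else 0)"
    unfolding fps_mult_nth by (rule sum.cong) (auto simp: assms)
  then show ?thesis by simp
qed

lemma mult_nth_order_right:
  fixes E F :: "'a fps"
  assumes "\<And>k. k < n \<Longrightarrow> E $ k = 0"
  shows "(F * E) $ n = F $ 0 * E $ n"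
proof -
  have "(F * E) $ n = (\<Sum>i=0..n. if i = 0 then F $ 0 * E $ n else 0)"
    unfolding fps_mult_nth by (rule sum.cong) (auto simp: assms)
  then show ?thesis by simp
qed

definition mult_defect ::
    "('a fps \<Rightarrow> 'a fps \<Rightarrow> 'a fps) \<Rightarrow> (nat \<Rightarrow> 'a \<Rightarrow> 'a) \<Rightarrow> 'a fps \<Rightarrow> 'a fps \<Rightarrow> 'a fps" where
  "mult_defect \<mu> g f h = series_map g (\<mu> f h) - series_map g f * series_map g h"

lemma mult_defect_nth_cong:
  assumes "\<And>i. i \<le> n \<Longrightarrow> g i = g' i"
  shows "mult_defect \<mu> g f h $ n = mult_defect \<mu> g' f h $ n"
proof -
  have "series_map g f $ k = series_map g' f $ k" if "k \<le> n" for f k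
    using assms that by (intro series_map_nth_cong) auto
  then show ?thesis by (simp add: mult_defect_def fps_mult_nth)
qed

lemma power_series_linear_mult_defect:
  assumes "formal_deformation scale \<mu>" and "\<And>i. lin (g i)"
  shows "power_series_linear (mult_defect \<mu> g f)" and "power_series_linear (\<lambda>f. mult_defect \<mu> g f h)"
proof -
  interpret \<Phi>: module_hom "fps_scale scale" "fps_scale scale" "series_map g"
    by (rule power_series_linear_series_map[OF assms(2)])
  have r: "power_series_linear (\<mu> f)" and l: "power_series_linear (\<lambda>f. \<mu> f h)" for f h
    using assms(1) by (auto simp: formal_deformation_def)
  show "power_series_linear (mult_defect \<mu> g f)"
    by (rule power_series_linearI)
       (simp_all add: mult_defect_def module_hom.add[OF r] module_hom.scale[OF r] \<Phi>.add \<Phi>.scale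
          algebra_simps fps_scale_mult_right \<Phi>.m1.scale_right_diff_distrib)
  show "power_series_linear (\<lambda>f. mult_defect \<mu> g f h)"
    by (rule power_series_linearI)
       (simp_all add: mult_defect_def module_hom.add[OF l] module_hom.scale[OF l] \<Phi>.add \<Phi>.scale
          algebra_simps fps_scale_mult_left \<Phi>.m1.scale_right_diff_distrib)
qed

lemma deformation_nth_0: "formal_deformation scale \<mu> \<Longrightarrow> \<mu> f h $ 0 = f $ 0 * h $ 0"
  by (simp add: formal_deformation_def)

text \<open>
  The first obstruction is a cocycle. Expanding \<open>\<Phi> (\<mu> (\<mu> a b) c) = \<Phi> (\<mu> a (\<mu> b c))\<close> by two
  applications of \<open>\<Phi> (\<mu> f h) = D f h + \<Phi> f * \<Phi> h\<close> on each side, the triple products cancel and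
  the coefficient of \<open>t\<^sup>n\<close> of what remains is the cocycle identity.
\<close>

lemma obstruction_cocycle:
  assumes \<mu>: "formal_deformation scale \<mu>" and g: "\<And>i. lin (g i)" and "g 0 = id"
    and low: "\<And>a b k. k < n \<Longrightarrow> mult_defect \<mu> g (fps_const a) (fps_const b) $ k = 0"
  shows "(\<lambda>a b. mult_defect \<mu> g (fps_const a) (fps_const b) $ n) \<in> cocycles2 scale UNIV"
proof -
  let ?D = "mult_defect \<mu> g" and ?\<Phi> = "series_map g"
  note lins = power_series_linear_mult_defect[OF \<mu> g]
  note order = power_series_bilinear_order[OF lins low]
  have add_const: "fps_const (a + b) = fps_const a + fps_const b"
    and scale_const: "fps_const (scale c a) = fps_scale scale (fps_const c) (fps_const a)"
    for a b :: 'a and c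
    by (auto intro: fps_ext simp: fps_scale_const_nth lin_zero)
  have "a * ?D (fps_const b) (fps_const c) $ n + ?D (fps_const a) (fps_const (b * c)) $ n =
      ?D (fps_const (a * b)) (fps_const c) $ n + ?D (fps_const a) (fps_const b) $ n * c" for a b c
  proof -
    let ?a = "fps_const a" and ?b = "fps_const b" and ?c = "fps_const c"
    have "\<mu> (\<mu> ?a ?b) ?c = \<mu> ?a (\<mu> ?b ?c)"
      using \<mu> by (simp add: formal_deformation_def)
    moreover have "?\<Phi> (\<mu> f h) = ?D f h + ?\<Phi> f * ?\<Phi> h" for f h
      by (simp add: mult_defect_def)
    ultimately have "?D (\<mu> ?a ?b) ?c + (?D ?a ?b + ?\<Phi> ?a * ?\<Phi> ?b) * ?\<Phi> ?c =
        ?D ?a (\<mu> ?b ?c) + ?\<Phi> ?a * (?D ?b ?c + ?\<Phi> ?b * ?\<Phi> ?c)"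
      by metis
    then have "?D (\<mu> ?a ?b) ?c + ?D ?a ?b * ?\<Phi> ?c = ?D ?a (\<mu> ?b ?c) + ?\<Phi> ?a * ?D ?b ?c"
      by (simp add: algebra_simps)
    then have "(?D (\<mu> ?a ?b) ?c + ?D ?a ?b * ?\<Phi> ?c) $ n =
        (?D ?a (\<mu> ?b ?c) + ?\<Phi> ?a * ?D ?b ?c) $ n" by (rule arg_cong)
    moreover have "(?D ?a ?b * ?\<Phi> ?c) $ n = ?D ?a ?b $ n * c"
      using mult_nth_order_left[of n "?D ?a ?b"] low \<open>g 0 = id\<close> by (simp add: series_map_nth)
    moreover have "(?\<Phi> ?a * ?D ?b ?c) $ n = a * ?D ?b ?c $ n"
      using mult_nth_order_right[of n "?D ?b ?c"] low \<open>g 0 = id\<close> by (simp add: series_map_nth)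
    moreover have "?D (\<mu> ?a ?b) ?c $ n = ?D (fps_const (a * b)) ?c $ n"
      using order(2)[where f="\<mu> ?a ?b" and h="?c"] by (simp add: deformation_nth_0[OF \<mu>])
    moreover have "?D ?a (\<mu> ?b ?c) $ n = ?D ?a (fps_const (b * c)) $ n"
      using order(2)[where f="?a" and h="\<mu> ?b ?c"] by (simp add: deformation_nth_0[OF \<mu>])
    ultimately show ?thesis by (simp add: add.commute)
  qed
  moreover have "?D (fps_const a) (fps_const (b + c)) =
        ?D (fps_const a) (fps_const b) + ?D (fps_const a) (fps_const c)"
    and "?D (fps_const (a + b)) (fps_const c) =
        ?D (fps_const a) (fps_const c) + ?D (fps_const b) (fps_const c)"
    and "?D (fps_const a) (fps_const (scale k b)) =
        fps_scale scale (fps_const k) (?D (fps_const a) (fps_const b))"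
    and "?D (fps_const (scale k a)) (fps_const b) =
        fps_scale scale (fps_const k) (?D (fps_const a) (fps_const b))" for a b c k
    unfolding add_const scale_const
    by (fact module_hom.add[OF lins(1)] module_hom.add[OF lins(2)]
        module_hom.scale[OF lins(1)] module_hom.scale[OF lins(2)])+
  ultimately show ?thesis
    by (auto simp: cocycles2_UNIV_iff fps_scale_const_nth simp del: fps_const_add intro!: linI)
qed

text \<open>
  Changing the coefficient of \<open>t\<^sup>n\<close> from \<open>0\<close> to \<open>r\<close> lowers the \<open>n\<close>-th defect by the Hochschild
  coboundary of \<open>r\<close>, because \<open>g\<^sub>0\<close> is the identity and \<open>\<mu>\<close> is the product of \<open>A\<close> modulo \<open>t\<close>.
\<close>

lemma mult_defect_nth_update:
  assumes \<mu>: "formal_deformation scale \<mu>" and "0 < n" and g0: "g 0 = id" and gn: "g n = (\<lambda>x. 0)"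
  shows "mult_defect \<mu> (g(n := r)) (fps_const a) (fps_const b) $ n =
      mult_defect \<mu> g (fps_const a) (fps_const b) $ n - (a * r b - r (a * b) + r a * b)"
proof -
  define \<epsilon> where "\<epsilon> = series_map (\<lambda>i. if i = n then r else (\<lambda>x. 0))"
  have split: "series_map (g(n := r)) f = series_map g f + \<epsilon> f" for f
    by (rule fps_ext)
       (auto simp: series_map_nth \<epsilon>_def gn simp flip: sum.distrib intro!: sum.cong)
  have low: "\<epsilon> f $ k = 0" if "k < n" for f k
    using that by (simp add: \<epsilon>_def series_map_nth)
  have lead: "\<epsilon> f $ n = r (f $ 0)" for f
  proof -
    have "\<epsilon> f $ n = (\<Sum>i=0..n. if i = n then r (f $ 0) else 0)"
      unfolding \<epsilon>_def series_map_nth by (rule sum.cong) auto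
    then show ?thesis by simp
  qed
  have zero: "series_map g f $ 0 = f $ 0" for f
    by (simp add: series_map_nth g0)
  let ?a = "fps_const a" and ?b = "fps_const b"
  have "(\<epsilon> ?a * series_map g ?b) $ n = r a * b"
    by (subst mult_nth_order_left) (simp_all add: low lead zero)
  moreover have "(series_map g ?a * \<epsilon> ?b) $ n = a * r b"
    by (subst mult_nth_order_right) (simp_all add: low lead zero)
  moreover have "(\<epsilon> ?a * \<epsilon> ?b) $ n = 0"
    using \<open>0 < n\<close> by (subst mult_nth_order_left) (simp_all add: low)
  ultimately show ?thesis
    by (simp add: mult_defect_def split distrib_left distrib_right lead deformation_nth_0[OF \<mu>]
        algebra_simps)
qed

text \<open>
  Gerstenhaber's argument. The maps \<open>g\<^sub>n\<close> of an equivalence are chosen by recursion on \<open>n\<close>: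
  given \<open>g\<^sub>i\<close> for \<open>i < n\<close>, the defect modulo \<open>t\<^sup>n\<^sup>+\<^sup>1\<close> is a cocycle times \<open>t\<^sup>n\<close>, and \<open>g\<^sub>n\<close> kills it
  exactly when its Hochschild coboundary is that cocycle.
\<close>

theorem rigid_if_cocycles_coboundaries:
  assumes "cocycles2 scale UNIV \<subseteq> coboundaries2 scale UNIV"
  shows "rigid scale"
  unfolding rigid_def
proof (intro allI impI)
  fix \<mu> assume \<mu>: "formal_deformation scale \<mu>"
  let ?P = "\<lambda>g n r. lin r \<and> (n = 0 \<longrightarrow> r = id) \<and>
      (\<forall>a b. mult_defect \<mu> (g(n := r)) (fps_const a) (fps_const b) $ n = 0)"
  have "\<exists>g. \<forall>n. ?P g n (g n)"
  proof (rule dependent_wf_choice[OF wf_less_than])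
    fix g g' :: "nat \<Rightarrow> 'a \<Rightarrow> 'a" and n and r :: "'a \<Rightarrow> 'a"
    assume "\<And>k. (k, n) \<in> less_than \<Longrightarrow> g k = g' k"
    then have "mult_defect \<mu> (g(n := r)) f h $ n = mult_defect \<mu> (g'(n := r)) f h $ n" for f h
      by (intro mult_defect_nth_cong) auto
    then show "?P g n r = ?P g' n r" by simp
  next
    fix n and g :: "nat \<Rightarrow> 'a \<Rightarrow> 'a"
    assume "\<And>k. (k, n) \<in> less_than \<Longrightarrow> ?P g k (g k)"
    then have IH: "?P g k (g k)" if "k < n" for k using that by simp
    show "\<exists>r. ?P g n r"
    proof (cases "n = 0")
      case True
      then have "?P g n id"
        by (auto simp: mult_defect_def series_map_nth fps_mult_nth deformation_nth_0[OF \<mu>] intro: linI)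
      then show ?thesis by blast
    next
      case False
      \<comment> \<open>Only the values of \<open>g\<close> below \<open>n\<close> are known to be linear; the truncation is linear throughout.\<close>
      define g' where "g' = (\<lambda>i. if i < n then g i else (\<lambda>x. 0))"
      have lin: "lin (g' i)" for i
        using IH by (auto simp: g'_def intro: linI)
      have g0: "g' 0 = id" and gn: "g' n = (\<lambda>x. 0)"
        using IH[of 0] False by (auto simp: g'_def)
      have "mult_defect \<mu> g' (fps_const a) (fps_const b) $ k = 0" if "k < n" for a b k
      proof -
        have "mult_defect \<mu> g' (fps_const a) (fps_const b) $ k =
            mult_defect \<mu> (g(k := g k)) (fps_const a) (fps_const b) $ k"
          using that by (intro mult_defect_nth_cong) (simp add: g'_def)
        then show ?thesis using IH[OF that] by simp
      qed
      from obstruction_cocycle[OF \<mu> lin g0 this] assms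
      obtain r where r: "lin r" "\<And>a b. mult_defect \<mu> g' (fps_const a) (fps_const b) $ n =
          a * r b - r (a * b) + r a * b"
        unfolding coboundaries2_UNIV_iff subset_iff by blast
      have "mult_defect \<mu> (g(n := r)) (fps_const a) (fps_const b) $ n = 0" for a b
      proof -
        have "mult_defect \<mu> (g(n := r)) (fps_const a) (fps_const b) $ n =
            mult_defect \<mu> (g'(n := r)) (fps_const a) (fps_const b) $ n"
          by (intro mult_defect_nth_cong) (auto simp: g'_def)
        also have "\<dots> = 0"
          using mult_defect_nth_update[OF \<mu> _ g0 gn] False r(2) by simp
        finally show ?thesis .
      qed
      with r(1) False show ?thesis by blast
    qed
  qed
  then obtain g where g: "\<And>n. ?P g n (g n)" by blast
  let ?\<Phi> = "series_map g"
  have lin: "lin (g i)" for i using g by blast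
  have g0: "g 0 = id" using g by blast
  have "mult_defect \<mu> g (fps_const a) (fps_const b) $ k = 0" for a b k
    using g[of k] by simp
  then have "mult_defect \<mu> g f h $ k = 0" for f h k
    using power_series_bilinear_order(1)[OF power_series_linear_mult_defect[OF \<mu> lin], where n = "Suc k" and k = k]
    by simp
  then have "mult_defect \<mu> g f h = 0" for f h
    by (auto intro: fps_ext)
  then have "?\<Phi> (\<mu> f h) = ?\<Phi> f * ?\<Phi> h" for f h
    by (simp add: mult_defect_def)
  moreover have "?\<Phi> f $ 0 = f $ 0" for f
    by (simp add: series_map_nth g0)
  ultimately show "equivalent_deformations scale \<mu> (*)"
    unfolding equivalent_deformations_def
    by (intro exI[of _ ?\<Phi>] conjI allI power_series_linear_series_map[OF lin]
        bij_series_map[of g, OF g0])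
qed

end

section \<open>The Nakayama automorphism acts trivially on second cohomology\<close>

lemma sum_cyclic_shift:
  fixes F :: "nat \<Rightarrow> 'b::ab_group_add"
  assumes "F m = F 0"
  shows "(\<Sum>j<m. F (Suc j)) = (\<Sum>j<m. F j)"
  using sum.lessThan_Suc_shift[of F m] sum.lessThan_Suc[of F m] assms by simp

context fd_algebra
begin

lemma frobenius_form_linear:
  assumes "frobenius_homomorphism scale \<phi>"
  shows "\<phi> (x + y) = \<phi> x + \<phi> y" and "\<phi> (x - y) = \<phi> x - \<phi> y" and "\<phi> (scale c x) = c * \<phi> x"
proof -
  have *: "Vector_Spaces.linear scale (*) \<phi>"
    using assms by (simp add: frobenius_homomorphism_def dual_space_def)
  show "\<phi> (x + y) = \<phi> x + \<phi> y" and "\<phi> (scale c x) = c * \<phi> x"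
    using * by (simp_all add: Vector_Spaces.linear_iff)
  show "\<phi> (x - y) = \<phi> x - \<phi> y"
    using * by (simp add: module_hom.diff[of scale "(*)"] linear_iff_module_hom)
qed

lemma frobenius_form_nondegenerate:
  assumes "frobenius_homomorphism scale \<phi>" and "\<And>z. \<phi> (z * x) = \<phi> (z * y)"
  shows "x = y"
proof -
  have "inj (\<lambda>x. dual_lact x \<phi>)"
    using assms(1)
    by (simp add: frobenius_homomorphism_def left_module_iso_dual_def bij_betw_def)
  moreover have "dual_lact x \<phi> = dual_lact y \<phi>"
    using assms(2) by (simp add: dual_lact_def)
  ultimately show ?thesis by (rule injD)
qed

lemma frobenius_form_represents:
  assumes "frobenius_homomorphism scale \<phi>"
    and "\<And>x y. h (x + y) = h x + h y" and "\<And>c x. h (scale c x) = c * h x"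
  shows "\<exists>y. \<forall>z. \<phi> (z * y) = h z"
proof -
  have "vector_space ((*) :: 'k \<Rightarrow> 'k \<Rightarrow> 'k)"
    by unfold_locales (simp_all add: algebra_simps)
  then have "h \<in> dual_space scale"
    using assms(2,3) vector_space_axioms by (simp add: dual_space_def Vector_Spaces.linear_iff)
  then have "h \<in> range (\<lambda>x. dual_lact x \<phi>)"
    using assms(1)
    by (simp add: frobenius_homomorphism_def left_module_iso_dual_def bij_betw_def)
  then show ?thesis by (auto simp: dual_lact_def)
qed

lemma automorphismD:
  assumes "algebra_automorphism scale e \<rho>"
  shows "lin \<rho>" and "bij \<rho>" and "\<rho> (x * y) = \<rho> x * \<rho> y" and "\<rho> e = e"
  using assms by (simp_all add: algebra_automorphism_def Vector_Spaces.linear_iff linear_on_def)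

lemma automorphism_inv:
  assumes "algebra_automorphism scale e \<rho>"
  shows "\<rho> (inv \<rho> x) = x" and "inv \<rho> (\<rho> x) = x" and "lin (inv \<rho>)"
    and "inv \<rho> (x * y) = inv \<rho> x * inv \<rho> y"
proof -
  note \<rho> = automorphismD[OF assms]
  show 1: "\<rho> (inv \<rho> x) = x" for x using \<rho>(2) by (simp add: bij_is_surj surj_f_inv_f)
  show 2: "inv \<rho> (\<rho> x) = x" for x using \<rho>(2) by (simp add: bij_is_inj)
  show "inv \<rho> (x * y) = inv \<rho> x * inv \<rho> y"
    using 2[of "inv \<rho> x * inv \<rho> y"] by (simp add: \<rho>(3) 1)
  show "lin (inv \<rho>)"
  proof (rule linI)
    fix x y c
    show "inv \<rho> (x + y) = inv \<rho> x + inv \<rho> y"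
      using 2[of "inv \<rho> x + inv \<rho> y"] by (simp add: lin_add[OF \<rho>(1)] 1)
    show "inv \<rho> (scale c x) = scale c (inv \<rho> x)"
      using 2[of "scale c (inv \<rho> x)"] by (simp add: lin_scale[OF \<rho>(1)] 1)
  qed
qed

text \<open>
  The right action of an automorphism on cochains.
\<close>

definition twist :: "('a \<Rightarrow> 'a) \<Rightarrow> ('a \<Rightarrow> 'a \<Rightarrow> 'a) \<Rightarrow> 'a \<Rightarrow> 'a \<Rightarrow> 'a" where
  "twist \<rho> f = (\<lambda>x y. inv \<rho> (f (\<rho> x) (\<rho> y)))"

lemma twist_cocycle:
  assumes \<rho>: "algebra_automorphism scale e \<rho>" and f: "f \<in> cocycles2 scale UNIV"
  shows "twist \<rho> f \<in> cocycles2 scale UNIV"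
proof -
  note aut = automorphismD[OF \<rho>] and inv = automorphism_inv[OF \<rho>]
  have "x * twist \<rho> f y z + twist \<rho> f x (y * z) =
      twist \<rho> f (x * y) z + twist \<rho> f x y * z" for x y z
    using arg_cong[OF cocycle_eq[OF f, of "\<rho> x" "\<rho> y" "\<rho> z"], of "inv \<rho>"]
    by (simp add: twist_def lin_add[OF inv(3)] inv aut(3))
  moreover have "lin (twist \<rho> f x)" for x
    by (rule linI)
       (simp_all add: twist_def lin_add[OF aut(1)] lin_add[OF cocycle_lin_right[OF f]]
          lin_add[OF inv(3)] lin_scale[OF aut(1)] lin_scale[OF cocycle_lin_right[OF f]]
          lin_scale[OF inv(3)])
  moreover have "lin (\<lambda>x. twist \<rho> f x y)" for y
    by (rule linI)
       (simp_all add: twist_def lin_add[OF aut(1)] lin_add[OF cocycle_lin_left[OF f]]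
          lin_add[OF inv(3)] lin_scale[OF aut(1)] lin_scale[OF cocycle_lin_left[OF f]]
          lin_scale[OF inv(3)])
  ultimately show ?thesis by (simp add: cocycles2_UNIV_iff)
qed

text \<open>
  Nondegeneracy of \<open>\<phi>\<close> turns a cochain \<open>f\<close> into the form \<open>F(x, a, b) = \<phi>(x f(a, b))\<close>, and the
  relation \<open>\<phi>(u c) = \<phi>(\<rho>(c) u)\<close> turns the cocycle identity into
  \<open>F(p, q, s) - F(1, p q, s) + F(1, p, q s) - F(\<rho>(s), p, q) = 0\<close>.
  On such forms Connes' operator is a homotopy between the identity and the simultaneous action of
  \<open>\<rho>\<close> on all arguments. In this degree it is \<open>G(x, a) = F(1, x, a) - F(1, \<rho>(a), x)\<close>, which \<open>\<phi>\<close> turns back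
  into a 1-cochain \<open>g\<close>. The coboundary of \<open>g\<close> is evaluated by the cocycle identity at
  \<open>(x, a, b)\<close>, \<open>(\<rho>(b), x, a)\<close> and \<open>(\<rho>(a), \<rho>(b), x)\<close>, whose correction terms telescope.
\<close>

lemma twist_cohomologous:
  assumes \<phi>: "frobenius_homomorphism scale \<phi>"
    and \<rho>: "nakayama_automorphism scale e \<phi> \<rho>"
    and f: "f \<in> cocycles2 scale UNIV"
  shows "(\<lambda>x y. f x y - twist \<rho> f x y) \<in> coboundaries2 scale UNIV"
proof -
  have aut: "algebra_automorphism scale e \<rho>"
    and nak: "\<And>x a. \<phi> (a * x) = \<phi> (\<rho> x * a)"
    using \<rho> by (auto simp: nakayama_automorphism_def dual_lact_def dual_ract_def fun_eq_iff)
  note lin\<rho> = automorphismD(1)[OF aut] and r = cocycle_lin_right[OF f] and l = cocycle_lin_left[OF f]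
  note \<phi>_lin = frobenius_form_linear[OF \<phi>]
  note lins = lin_add[OF r] lin_add[OF l] lin_scale[OF r] lin_scale[OF l] lin_add[OF lin\<rho>]
    lin_scale[OF lin\<rho>] \<phi>_lin
  have \<phi>\<rho>: "\<phi> (\<rho> x) = \<phi> x" for x
    using nak[of e x] by (simp add: unit_left unit_right)
  have "\<forall>a. \<exists>y. \<forall>x. \<phi> (x * y) = \<phi> (f x a) - \<phi> (f (\<rho> a) x)"
    by (intro allI frobenius_form_represents[OF \<phi>]) (simp_all add: lins algebra_simps)
  then obtain g where g: "\<And>a x. \<phi> (x * g a) = \<phi> (f x a) - \<phi> (f (\<rho> a) x)"
    by metis
  show ?thesis
  proof (rule coboundaryI)
    show "lin g"
    proof (rule linI; rule frobenius_form_nondegenerate[OF \<phi>])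
      fix x y z c
      show "\<phi> (z * g (x + y)) = \<phi> (z * (g x + g y))"
        by (simp add: g distrib_left lins)
      show "\<phi> (z * g (scale c x)) = \<phi> (z * scale c (g x))"
        by (simp add: g scale_mult_right lins algebra_simps)
    qed
    fix a b
    show "f a b - twist \<rho> f a b = a * g b - g (a * b) + g a * b"
    proof (rule frobenius_form_nondegenerate[OF \<phi>])
      fix x
      have cyc: "\<phi> (p * f q s) + \<phi> (f p (q * s)) = \<phi> (f (p * q) s) + \<phi> (\<rho> s * f p q)" for p q s
        using arg_cong[OF cocycle_eq[OF f, of p q s], of \<phi>] nak[of "f p q" s] by (simp add: \<phi>_lin)
      have "\<phi> (x * twist \<rho> f a b) = \<phi> (\<rho> x * f (\<rho> a) (\<rho> b))"
        using \<phi>\<rho>[of "x * twist \<rho> f a b"]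
        by (simp add: twist_def automorphismD(3)[OF aut] automorphism_inv(1)[OF aut])
      then have lhs: "\<phi> (x * (f a b - twist \<rho> f a b)) = \<phi> (x * f a b) - \<phi> (\<rho> x * f (\<rho> a) (\<rho> b))"
        by (simp add: right_diff_distrib \<phi>_lin)
      have "\<phi> (x * (g a * b)) = \<phi> ((\<rho> b * x) * g a)"
        using nak[of "x * g a" b] by (simp add: mult.assoc)
      then have "\<phi> (x * (a * g b - g (a * b) + g a * b)) =
          \<phi> ((x * a) * g b) - \<phi> (x * g (a * b)) + \<phi> ((\<rho> b * x) * g a)"
        by (simp add: distrib_left right_diff_distrib \<phi>_lin mult.assoc)
      also have "\<dots> = (\<phi> (f (x * a) b) - \<phi> (f x (a * b)))
          + (\<phi> (f (\<rho> b * x) a) - \<phi> (f (\<rho> b) (x * a)))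
          + (\<phi> (f (\<rho> a * \<rho> b) x) - \<phi> (f (\<rho> a) (\<rho> b * x)))"
        unfolding g by (simp add: automorphismD(3)[OF aut])
      also have "\<phi> (f (x * a) b) - \<phi> (f x (a * b)) = \<phi> (x * f a b) - \<phi> (\<rho> b * f x a)"
        using cyc[of x a b] by (simp add: algebra_simps)
      also have "\<phi> (f (\<rho> b * x) a) - \<phi> (f (\<rho> b) (x * a)) = \<phi> (\<rho> b * f x a) - \<phi> (\<rho> a * f (\<rho> b) x)"
        using cyc[of "\<rho> b" x a] by (simp add: algebra_simps)
      also have "\<phi> (f (\<rho> a * \<rho> b) x) - \<phi> (f (\<rho> a) (\<rho> b * x)) =
          \<phi> (\<rho> a * f (\<rho> b) x) - \<phi> (\<rho> x * f (\<rho> a) (\<rho> b))"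
        using cyc[of "\<rho> a" "\<rho> b" x] by (simp add: algebra_simps)
      finally show "\<phi> (x * (f a b - twist \<rho> f a b)) = \<phi> (x * (a * g b - g (a * b) + g a * b))"
        unfolding lhs by simp
    qed
  qed
qed

lemma scale_average_constant:
  assumes "of_nat m \<noteq> (0 :: 'k)"
  shows "scale (inverse (of_nat m)) (\<Sum>j<m. x) = x"
proof -
  have "(\<Sum>j<m. x) = scale (of_nat m) x"
    by (induction m) (simp_all add: scale_left_distrib)
  then show ?thesis using assms by simp
qed

text \<open>
  Since twisting does not change the class, the average over the finite group generated by \<open>\<rho>\<close>
  represents the same class; the order of the group has to be invertible.
\<close>

lemma invariant_representative:
  assumes \<phi>: "frobenius_homomorphism scale \<phi>"
    and \<rho>: "nakayama_automorphism scale e \<phi> \<rho>"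
    and order: "\<rho> ^^ m = id" and m: "of_nat m \<noteq> (0 :: 'k)"
    and f: "f \<in> cocycles2 scale UNIV"
  shows "\<exists>h \<in> cocycles2 scale UNIV. (\<lambda>x y. f x y - h x y) \<in> coboundaries2 scale UNIV \<and>
      (\<forall>x y. h (\<rho> x) (\<rho> y) = \<rho> (h x y))"
proof -
  have aut: "algebra_automorphism scale e \<rho>"
    using \<rho> by (simp add: nakayama_automorphism_def)
  note inv = automorphism_inv[OF aut]
  define F where "F j = (twist \<rho> ^^ j) f" for j
  have F_Suc: "F (Suc j) = twist \<rho> (F j)" for j
    by (simp add: F_def)
  have F_cocycle: "F j \<in> cocycles2 scale UNIV" for j
    by (induction j) (simp_all add: F_def f twist_cocycle[OF aut])
  have F_cohom: "(\<lambda>x y. f x y - F j x y) \<in> coboundaries2 scale UNIV" for j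
  proof (induction j)
    case 0 then show ?case by (simp add: F_def zero_coboundary)
  next
    case (Suc j)
    from coboundary_add[OF Suc twist_cohomologous[OF \<phi> \<rho> F_cocycle[of j]]]
    show ?case by (simp add: F_Suc)
  qed
  have F_eq: "F j x y = (inv \<rho> ^^ j) (f ((\<rho> ^^ j) x) ((\<rho> ^^ j) y))" for j x y
  proof (induction j arbitrary: x y)
    case 0 then show ?case by (simp add: F_def)
  next
    case (Suc j)
    show ?case by (simp add: F_Suc twist_def Suc funpow_swap1[of \<rho>])
  qed
  have "inv \<rho> ^^ m = id"
    using inv_fn[OF automorphismD(2)[OF aut], of m] order by simp
  then have F_m: "F m = F 0"
    by (simp add: fun_eq_iff F_eq order)
  define h where "h = (\<lambda>x y. scale (inverse (of_nat m)) (\<Sum>j<m. F j x y))"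
  have diff: "(\<lambda>x y. f x y - h x y) =
      (\<lambda>x y. scale (inverse (of_nat m)) (\<Sum>j<m. f x y - F j x y))"
    by (simp add: fun_eq_iff h_def sum_subtractf scale_right_diff_distrib scale_average_constant[OF m])
  have cohom: "(\<lambda>x y. f x y - h x y) \<in> coboundaries2 scale UNIV"
    unfolding diff by (intro coboundary_scale coboundary_sum F_cohom)
  have "h \<in> cocycles2 scale UNIV"
    using cocycle_diff[OF f coboundary_cocycle[OF cohom]] by simp
  moreover have "h (\<rho> x) (\<rho> y) = \<rho> (h x y)" for x y
  proof -
    have "inv \<rho> (h (\<rho> x) (\<rho> y)) = scale (inverse (of_nat m)) (\<Sum>j<m. F (Suc j) x y)"
      by (simp add: h_def lin_scale[OF inv(3)] lin_sum[OF inv(3)] F_Suc twist_def)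
    also have "\<dots> = h x y"
      using sum_cyclic_shift[of "\<lambda>j. F j x y" m] by (simp add: F_m h_def)
    finally show ?thesis using inv(1) by metis
  qed
  ultimately show ?thesis using cohom by blast
qed

end

section \<open>Descent along a separable Frobenius extension\<close>

text \<open>
  A Frobenius extension \<open>S \<subseteq> A\<close> with trace \<open>p\<close> and dual bases \<open>u\<close>, \<open>v\<close>, in which \<open>p\<close> is a projection
  and the index \<open>\<Sum>\<^sub>t u\<^sub>t v\<^sub>t\<close> is an invertible scalar \<open>c\<close>. The two dual basis identities say that
  \<open>\<Sum>\<^sub>t u\<^sub>t \<otimes> v\<^sub>t \<in> A \<otimes>\<^sub>S A\<close> commutes with \<open>A\<close>, so that \<open>c\<inverse> \<Sum>\<^sub>t u\<^sub>t \<otimes> v\<^sub>t\<close> is a separability idempotent.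
\<close>

locale separable_frobenius_extension = fd_algebra scale e
  for scale :: "'k::field \<Rightarrow> 'a::ring \<Rightarrow> 'a" and e :: 'a +
  fixes S :: "'a set" and p :: "'a \<Rightarrow> 'a"
    and T :: "'i set" and u v :: "'i \<Rightarrow> 'a" and c :: 'k
  assumes subspace: "subspace S" and mult_closed: "a \<in> S \<Longrightarrow> b \<in> S \<Longrightarrow> a * b \<in> S"
    and unit_in: "e \<in> S"
    and trace_in: "p x \<in> S" and trace_lin: "linear_on scale UNIV p"
    and trace_left: "a \<in> S \<Longrightarrow> p (a * x) = a * p x"
    and trace_unit: "p e = e"
    and dual_left: "(\<Sum>t\<in>T. p (x * u t) * v t) = x"
    and dual_right: "(\<Sum>t\<in>T. u t * p (v t * x)) = x"
    and index: "(\<Sum>t\<in>T. u t * v t) = scale c e" and index_nonzero: "c \<noteq> 0"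
begin

lemma trace_id: "a \<in> S \<Longrightarrow> p a = a"
  using trace_left[of a e] by (simp add: trace_unit unit_right)

text \<open>
  A 1-cochain of \<open>S\<close> extends to \<open>A\<close> by composition with the projection \<open>p\<close>.
\<close>

lemma kill_on_subalgebra:
  assumes HH2: "HH2_vanishes scale S"
    and f: "f \<in> cocycles2 scale UNIV" and f_in: "\<And>a b. a \<in> S \<Longrightarrow> b \<in> S \<Longrightarrow> f a b \<in> S"
  shows "\<exists>h \<in> cocycles2 scale UNIV. (\<lambda>x y. f x y - h x y) \<in> coboundaries2 scale UNIV \<and>
      (\<forall>a\<in>S. \<forall>b\<in>S. h a b = 0)"
proof -
  have closed: "0 \<in> S" "a \<in> S \<Longrightarrow> b \<in> S \<Longrightarrow> a + b \<in> S" "a \<in> S \<Longrightarrow> scale k a \<in> S" for a b k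
    using subspace by (simp_all add: subspace_0 subspace_add subspace_scale)
  define fS where "fS = (\<lambda>x y. if x \<in> S \<and> y \<in> S then f x y else 0)"
  have "fS \<in> cocycles2 scale S"
    unfolding cocycles2_def cochains2_def hochschild_d2_def fS_def
    using cocycle_eq[OF f] cocycle_lin_right[OF f] cocycle_lin_left[OF f]
    by (auto simp: f_in closed mult_closed linear_on_def fun_eq_iff algebra_simps)
  then have "fS \<in> coboundaries2 scale S"
    using HH2_vanishesD[OF HH2 closed(1)] by blast
  then obtain g where g: "linear_on scale S g" and fg: "fS = hochschild_d1 S g"
    by (auto simp: coboundaries2_def cochains1_def)
  define b where "b = (\<lambda>x y. x * g (p y) - g (p (x * y)) + g (p x) * y)"
  have "lin (\<lambda>x. g (p x))"
    using g trace_in trace_lin by (auto simp: linear_on_def)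
  then have b: "b \<in> coboundaries2 scale UNIV"
    unfolding b_def by (rule coboundaryI) simp
  have "f x y = b x y" if "x \<in> S" "y \<in> S" for x y
    using fun_cong[OF fun_cong[OF fg], of x y] that
    by (simp add: fS_def hochschild_d1_def b_def trace_id mult_closed)
  moreover have "(\<lambda>x y. f x y - b x y) \<in> cocycles2 scale UNIV"
    by (rule cocycle_diff[OF f coboundary_cocycle[OF b]])
  ultimately show ?thesis
    using b by (intro bexI[of _ "\<lambda>x y. f x y - b x y"]) auto
qed

text \<open>
  The vanishing of \<open>f\<close> on \<open>S \<times> S\<close> makes \<open>f\<close>, as a function of its first argument in \<open>S\<close>, a
  1-cocycle with values in \<open>Hom(A, A)\<close>. It is a coboundary because \<open>A\<close> is a projective left
  \<open>S\<close>-module; the dual basis makes this explicit, with \<open>g(x) = - \<Sum>\<^sub>t f(p(x u\<^sub>t), v\<^sub>t)\<close>.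
\<close>

lemma kill_subalgebra_left:
  assumes f: "f \<in> cocycles2 scale UNIV" and f0: "\<And>a b. a \<in> S \<Longrightarrow> b \<in> S \<Longrightarrow> f a b = 0"
  shows "\<exists>h \<in> cocycles2 scale UNIV. (\<lambda>x y. f x y - h x y) \<in> coboundaries2 scale UNIV \<and>
      (\<forall>a\<in>S. \<forall>x. h a x = 0)"
proof -
  note r = cocycle_lin_right[OF f] and l = cocycle_lin_left[OF f]
  define g where "g x = - (\<Sum>t\<in>T. f (p (x * u t)) (v t))" for x
  have g_lin: "lin g"
    by (rule linI)
       (simp_all add: g_def distrib_right scale_mult_left lin_add[OF trace_lin]
          lin_scale[OF trace_lin] lin_add[OF l] lin_scale[OF l] sum.distrib scale_sum_right)
  have g_eq: "a * g x - g (a * x) = f a x" if a: "a \<in> S" for a x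
  proof -
    have summand: "f (p (a * x * u t)) (v t) - a * f (p (x * u t)) (v t) = f a (p (x * u t) * v t)" for t
      using cocycle_eq[OF f, of a "p (x * u t)" "v t"] f0[OF a trace_in]
      by (simp add: mult.assoc trace_left[OF a] algebra_simps)
    have "a * g x - g (a * x) = (\<Sum>t\<in>T. f (p (a * x * u t)) (v t) - a * f (p (x * u t)) (v t))"
      by (simp add: g_def sum_subtractf sum_distrib_left)
    also have "\<dots> = f a (\<Sum>t\<in>T. p (x * u t) * v t)"
      by (simp add: summand lin_sum[OF r])
    finally show ?thesis by (simp add: dual_left)
  qed
  \<comment> \<open>On \<open>S\<close> the map \<open>g\<close> is right multiplication by \<open>g e\<close>. The correction is left \<open>A\<close>-linear, so it
    keeps the previous identity, and it makes the third term of the coboundary vanish on \<open>S\<close>.\<close>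
  define k where "k x = g x - x * g e" for x
  have k0: "k a = 0" if "a \<in> S" for a
    using g_eq[OF that, of e] f0[OF that unit_in] by (simp add: k_def unit_right)
  define b where "b = (\<lambda>x y. x * k y - k (x * y) + k x * y)"
  have "lin k"
    by (rule linI)
       (simp_all add: k_def lin_add[OF g_lin] lin_scale[OF g_lin] distrib_right scale_mult_left
          scale_right_diff_distrib)
  then have b: "b \<in> coboundaries2 scale UNIV"
    unfolding b_def by (rule coboundaryI) simp
  have "b a x = f a x" if "a \<in> S" for a x
    using g_eq[OF that, of x] k0[OF that] by (simp add: b_def k_def algebra_simps)
  moreover have "(\<lambda>x y. f x y - b x y) \<in> cocycles2 scale UNIV"
    by (rule cocycle_diff[OF f coboundary_cocycle[OF b]])
  ultimately show ?thesis
    using b by (intro bexI[of _ "\<lambda>x y. f x y - b x y"]) auto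
qed

text \<open>
  If \<open>f\<close> vanishes on \<open>S \<times> A\<close>, then \<open>f(_, y)\<close> is left \<open>S\<close>-linear, hence \<open>q \<otimes> r \<mapsto> q f(r, y)\<close> is
  defined on \<open>A \<otimes>\<^sub>S A\<close> and may be applied to the \<open>A\<close>-central element \<open>\<Sum>\<^sub>t u\<^sub>t \<otimes> v\<^sub>t\<close>. This contracts
  the cocycle identity at \<open>(v\<^sub>t, x, y)\<close> to \<open>c f = d g\<close> with \<open>g(x) = \<Sum>\<^sub>t u\<^sub>t f(v\<^sub>t, x)\<close>.
\<close>

lemma casimir_contraction:
  assumes f: "f \<in> cocycles2 scale UNIV" and f0: "\<And>a x. a \<in> S \<Longrightarrow> f a x = 0"
  shows "f \<in> coboundaries2 scale UNIV"
proof -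
  note r = cocycle_lin_right[OF f] and l = cocycle_lin_left[OF f]
  have S_lin: "f (a * x) y = a * f x y" if "a \<in> S" for a x y
    using cocycle_eq[OF f, of a x y] by (simp add: f0[OF that])
  have central: "(\<Sum>t\<in>T. x * u t * f (v t) y) = (\<Sum>t\<in>T. u t * f (v t * x) y)" for x y
  proof -
    have "(\<Sum>t\<in>T. x * u t * f (v t) y) =
        (\<Sum>t\<in>T. (\<Sum>s\<in>T. u s * p (v s * (x * u t))) * f (v t) y)"
      by (simp add: dual_right)
    also have "\<dots> = (\<Sum>t\<in>T. \<Sum>s\<in>T. u s * f (p (v s * x * u t) * v t) y)"
      by (simp add: sum_distrib_right mult.assoc S_lin[OF trace_in])
    also have "\<dots> = (\<Sum>s\<in>T. u s * f (\<Sum>t\<in>T. p (v s * x * u t) * v t) y)"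
      by (subst sum.swap) (simp add: sum_distrib_left lin_sum[OF l])
    finally show ?thesis by (simp add: dual_left)
  qed
  define g where "g x = (\<Sum>t\<in>T. u t * f (v t) x)" for x
  have "x * g y - g (x * y) + g x * y = scale c (f x y)" for x y
  proof -
    have "x * g y = (\<Sum>t\<in>T. u t * f (v t * x) y)"
      using central[of x y] by (simp add: g_def sum_distrib_left mult.assoc)
    then have "x * g y - g (x * y) + g x * y =
        (\<Sum>t\<in>T. u t * (f (v t * x) y + f (v t) x * y - f (v t) (x * y)))"
      by (simp add: g_def sum_distrib_right sum_subtractf sum.distrib algebra_simps)
    also have "\<dots> = (\<Sum>t\<in>T. u t * (v t * f x y))"
    proof (rule sum.cong[OF refl])
      fix t
      have "f (v t * x) y + f (v t) x * y - f (v t) (x * y) = v t * f x y"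
        using cocycle_eq[OF f, of "v t" x y] by (simp add: algebra_simps)
      then show "u t * (f (v t * x) y + f (v t) x * y - f (v t) (x * y)) = u t * (v t * f x y)"
        by simp
    qed
    also have "\<dots> = (\<Sum>t\<in>T. u t * v t) * f x y"
      by (simp add: sum_distrib_right mult.assoc)
    finally show ?thesis by (simp add: index scale_mult_left unit_left)
  qed
  moreover have "lin g"
    by (rule linI)
       (simp_all add: g_def lin_add[OF r] lin_scale[OF r] distrib_left scale_mult_right sum.distrib
          scale_sum_right)
  ultimately have "(\<lambda>x y. scale c (f x y)) \<in> coboundaries2 scale UNIV"
    by (intro coboundaryI) auto
  from coboundary_scale[OF this, of "inverse c"] show ?thesis
    by (simp add: index_nonzero)
qed

theorem coboundary_if_HH2_vanishes:
  assumes "HH2_vanishes scale S"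
    and "f \<in> cocycles2 scale UNIV" and "\<And>a b. a \<in> S \<Longrightarrow> b \<in> S \<Longrightarrow> f a b \<in> S"
  shows "f \<in> coboundaries2 scale UNIV"
proof -
  obtain g where g: "g \<in> cocycles2 scale UNIV" "(\<lambda>x y. f x y - g x y) \<in> coboundaries2 scale UNIV"
    "\<And>a b. a \<in> S \<Longrightarrow> b \<in> S \<Longrightarrow> g a b = 0"
    using kill_on_subalgebra[OF assms] by blast
  obtain h where h: "h \<in> cocycles2 scale UNIV" "(\<lambda>x y. g x y - h x y) \<in> coboundaries2 scale UNIV"
    "\<And>a x. a \<in> S \<Longrightarrow> h a x = 0"
    using kill_subalgebra_left[OF g(1,3)] by blast
  from casimir_contraction[OF h(1,3)] cohomologous_coboundary h(2) g(2) show ?thesis by blast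
qed

end

section \<open>The eigenspace grading as a separable Frobenius extension\<close>

lemma primitive_root_power_inj:
  fixes z :: "'k::field"
  assumes "primitive_root_of_unity m z" and "i < m" and "j < m" and "z ^ i = z ^ j"
  shows "i = j"
proof -
  have *: False if "i < j" "j < m" "z ^ i = z ^ j" for i j
  proof -
    have "z \<noteq> 0"
      using assms(1) by (auto simp: primitive_root_of_unity_def power_0_left)
    moreover have "z ^ j = z ^ i * z ^ (j - i)"
      using that(1) by (simp flip: power_add)
    ultimately have "z ^ (j - i) = 1"
      using that(3) by simp
    moreover have "1 \<le> j - i" "j - i < m" using that by auto
    ultimately show False
      using assms(1) by (auto simp: primitive_root_of_unity_def)
  qed
  show ?thesis
    using *[of i j] *[of j i] assms(2-4) by (metis linorder_neqE_nat)
qed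

lemma primitive_root_sum:
  fixes z :: "'k::field"
  assumes "primitive_root_of_unity m z" and "0 < j" and "j < m"
  shows "(\<Sum>i<m. (z ^ i) ^ j) = 0"
proof -
  have "z ^ j \<noteq> 1" and "z ^ m = 1"
    using assms by (auto simp: primitive_root_of_unity_def)
  moreover have swap: "(z ^ i) ^ j = (z ^ j) ^ i" for i
    by (simp add: power_mult[symmetric] mult.commute)
  ultimately show ?thesis
    using geometric_sum[of "z ^ j" m] swap[of m] by simp
qed

text \<open>
  The \<open>m - 1\<close> numbers \<open>w\<^sup>i\<close> with \<open>0 < i < m\<close> are roots of \<open>1 + X + \<dots> + X\<^sup>m\<^sup>-\<^sup>1\<close>. If \<open>m\<close> were zero in
  the field, then \<open>1\<close> would be one root too many.
\<close>

lemma primitive_root_of_nat_nonzero: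
  fixes w :: "'k::field"
  assumes "primitive_root_of_unity m w"
  shows "of_nat m \<noteq> (0 :: 'k)"
proof
  assume m0: "of_nat m = (0 :: 'k)"
  define q :: "'k poly" where "q = (\<Sum>j<m. monom 1 j)"
  have "m \<ge> 1" using assms by (simp add: primitive_root_of_unity_def)
  have coeff: "coeff q n = (if n < m then 1 else 0)" for n
    by (simp add: q_def coeff_sum)
  then have "q \<noteq> 0"
    using \<open>m \<ge> 1\<close> by (metis coeff_0 less_le_trans zero_less_one zero_neq_one)
  have "degree q \<le> m - 1"
    by (rule degree_le) (auto simp: coeff)
  have root: "poly q (w ^ i) = 0" if "i < m" for i
  proof (cases "i = 0")
    case True
    then show ?thesis using m0 by (simp add: q_def poly_sum poly_monom)
  next
    case False
    then show ?thesis
      using primitive_root_sum[OF assms _ that]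
      by (simp add: q_def poly_sum poly_monom power_mult[symmetric] mult.commute)
  qed
  have "inj_on (\<lambda>i. w ^ i) {..<m}"
    using primitive_root_power_inj[OF assms] by (auto intro: inj_onI)
  then have "m = card ((\<lambda>i. w ^ i) ` {..<m})"
    by (simp add: card_image)
  also have "\<dots> \<le> card {x. poly q x = 0}"
    using root poly_roots_finite[OF \<open>q \<noteq> 0\<close>] by (intro card_mono) auto
  also have "\<dots> \<le> degree q"
    by (rule card_poly_roots_bound[OF \<open>q \<noteq> 0\<close>])
  finally show False
    using \<open>degree q \<le> m - 1\<close> \<open>m \<ge> 1\<close> by linarith
qed

lemma primitive_root_inverse:
  "primitive_root_of_unity m w \<Longrightarrow> primitive_root_of_unity m (inverse w)"
  by (auto simp: primitive_root_of_unity_def power_inverse)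

context fd_algebra
begin

lemma subspace_prod_expansion:
  assumes "x \<in> subspace_prod scale U V" and scale_U: "\<And>c a. a \<in> U \<Longrightarrow> scale c a \<in> U"
  shows "\<exists>n u v. (\<forall>s<n. u s \<in> U \<and> v s \<in> V) \<and> x = (\<Sum>s<(n::nat). u s * v s)"
proof -
  from assms(1) have "x \<in> span {x * y | x y. x \<in> U \<and> y \<in> V}"
    by (simp add: subspace_prod_def)
  then show ?thesis
  proof (induction rule: span_induct_alt)
    case base
    show ?case by (rule exI[of _ 0]) simp
  next
    case (step c a y)
    then obtain a' b' where a: "a = a' * b'" "a' \<in> U" "b' \<in> V" by blast
    from step obtain n u v where y: "\<forall>s<n. u s \<in> U \<and> v s \<in> V" "y = (\<Sum>s<(n::nat). u s * v s)"
      by blast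
    have "(\<forall>s<Suc n. (u(n := scale c a')) s \<in> U \<and> (v(n := b')) s \<in> V) \<and>
        scale c a + y = (\<Sum>s<Suc n. (u(n := scale c a')) s * (v(n := b')) s)"
      using y a by (auto simp: scale_mult_left scale_U less_Suc_eq)
    then show ?case by blast
  qed
qed

lemma automorphism_funpow:
  assumes "algebra_automorphism scale e \<rho>"
  shows "lin (\<rho> ^^ j)" and "(\<rho> ^^ j) (x * y) = (\<rho> ^^ j) x * (\<rho> ^^ j) y"
    and "\<rho> x = scale z x \<Longrightarrow> (\<rho> ^^ j) x = scale (z ^ j) x"
proof -
  note aut = automorphismD[OF assms]
  show "lin (\<rho> ^^ j)"
    by (induction j) (auto simp: linear_on_def lin_add[OF aut(1)] lin_scale[OF aut(1)])
  show "(\<rho> ^^ j) (x * y) = (\<rho> ^^ j) x * (\<rho> ^^ j) y"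
    by (induction j) (simp_all add: aut(3))
  show "\<rho> x = scale z x \<Longrightarrow> (\<rho> ^^ j) x = scale (z ^ j) x"
    by (induction j) (simp_all add: lin_scale[OF aut(1)] mult.commute)
qed

definition average :: "('a \<Rightarrow> 'a) \<Rightarrow> nat \<Rightarrow> 'a \<Rightarrow> 'a" where
  "average \<rho> m x = scale (inverse (of_nat m)) (\<Sum>j<m. (\<rho> ^^ j) x)"

text \<open>
  The scalars \<open>(z\<^sup>i)\<^sup>j\<close> are the character table of \<open>\<int>/m\<close>; this is column orthogonality.
\<close>

lemma character_sum:
  assumes z: "primitive_root_of_unity m z"
  shows "(\<Sum>i<m. scale (inverse (of_nat m)) (\<Sum>j<m. scale ((z ^ i) ^ j) (F j))) = F 0"
proof -
  have m: "0 < m" and m0: "of_nat m \<noteq> (0 :: 'k)"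
    using z primitive_root_of_nat_nonzero[OF z] by (auto simp: primitive_root_of_unity_def)
  have "(\<Sum>i<m. \<Sum>j<m. scale ((z ^ i) ^ j) (F j)) = (\<Sum>j<m. scale (\<Sum>i<m. (z ^ i) ^ j) (F j))"
    by (subst sum.swap) (simp add: scale_sum_left)
  also have "\<dots> = (\<Sum>j<m. if j = 0 then scale (of_nat m) (F 0) else 0)"
    using primitive_root_sum[OF z] by (intro sum.cong) auto
  also have "\<dots> = scale (of_nat m) (F 0)"
    using m by simp
  finally show ?thesis
    using m0 by (simp flip: scale_sum_right)
qed

lemma average_dual_left:
  assumes \<rho>: "algebra_automorphism scale e \<rho>"
    and u: "\<And>s. s < n \<Longrightarrow> \<rho> (u s) = scale z (u s)" and uv: "(\<Sum>s<(n::nat). u s * v s) = e"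
  shows "(\<Sum>s<n. average \<rho> m (x * u s) * v s) =
      scale (inverse (of_nat m)) (\<Sum>j<m. scale (z ^ j) ((\<rho> ^^ j) x))"
proof -
  have "(\<Sum>s<n. average \<rho> m (x * u s) * v s) =
      (\<Sum>s<n. scale (inverse (of_nat m)) (\<Sum>j<m. scale (z ^ j) ((\<rho> ^^ j) x * (u s * v s))))"
    using automorphism_funpow(3)[OF \<rho> u]
    by (intro sum.cong refl)
       (simp add: average_def automorphism_funpow(2)[OF \<rho>] scale_mult_left scale_mult_right
          sum_distrib_right mult.assoc)
  also have "\<dots> = scale (inverse (of_nat m)) (\<Sum>j<m. scale (z ^ j) ((\<rho> ^^ j) x * (\<Sum>s<n. u s * v s)))"
    unfolding sum_distrib_left scale_sum_right by (rule sum.swap)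
  finally show ?thesis by (simp add: uv unit_right)
qed

lemma average_dual_right:
  assumes \<rho>: "algebra_automorphism scale e \<rho>"
    and v: "\<And>s. s < n \<Longrightarrow> \<rho> (v s) = scale z (v s)" and uv: "(\<Sum>s<(n::nat). u s * v s) = e"
  shows "(\<Sum>s<n. u s * average \<rho> m (v s * x)) =
      scale (inverse (of_nat m)) (\<Sum>j<m. scale (z ^ j) ((\<rho> ^^ j) x))"
proof -
  have "(\<Sum>s<n. u s * average \<rho> m (v s * x)) =
      (\<Sum>s<n. scale (inverse (of_nat m)) (\<Sum>j<m. scale (z ^ j) ((u s * v s) * (\<rho> ^^ j) x)))"
    using automorphism_funpow(3)[OF \<rho> v]
    by (intro sum.cong refl)
       (simp add: average_def automorphism_funpow(2)[OF \<rho>] scale_mult_left scale_mult_right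
          sum_distrib_left mult.assoc)
  also have "\<dots> = scale (inverse (of_nat m)) (\<Sum>j<m. scale (z ^ j) ((\<Sum>s<n. u s * v s) * (\<rho> ^^ j) x))"
    unfolding sum_distrib_right scale_sum_right by (rule sum.swap)
  finally show ?thesis by (simp add: uv unit_left)
qed

text \<open>
  Strong grading gives \<open>1 = \<Sum>\<^sub>s u\<^sub>i\<^sub>s v\<^sub>i\<^sub>s\<close> with \<open>u\<^sub>i\<^sub>s \<in> A\<^sub>i\<close> and \<open>v\<^sub>i\<^sub>s \<in> A\<^sub>-\<^sub>i\<close> for each degree \<open>i\<close>, and
  these elements for all \<open>i\<close> together are dual bases for the projection onto \<open>A\<^sub>0\<close>: the part
  of degree \<open>i\<close> of the dual basis sum is the projection of \<open>x\<close> onto one homogeneous component.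
\<close>

lemma strongly_graded_separable_frobenius:
  assumes \<rho>: "algebra_automorphism scale e \<rho>" and order: "\<rho> ^^ m = id"
    and w: "primitive_root_of_unity m w"
    and strong: "strongly_graded scale m (eigen_component scale \<rho> w)"
  shows "\<exists>(T :: (nat \<times> nat) set) u v.
      separable_frobenius_extension scale e (eigen_component scale \<rho> w 0) (average \<rho> m) T u v (of_nat m)"
proof -
  let ?G = "eigen_component scale \<rho> w"
  note aut = automorphismD[OF \<rho>] and pow = automorphism_funpow[OF \<rho>]
  have m: "0 < m" and m0: "of_nat m \<noteq> (0 :: 'k)" and wm: "w ^ m = 1"
    using w primitive_root_of_nat_nonzero[OF w] by (auto simp: primitive_root_of_unity_def)
  have w_nonzero: "w \<noteq> 0" using wm m by (auto simp: power_0_left)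
  have G0: "a \<in> ?G 0 \<longleftrightarrow> \<rho> a = a" for a by (simp add: eigen_component_def)
  have "\<exists>n u v. (\<forall>s<n. u s \<in> ?G i \<and> v s \<in> ?G ((m - i) mod m)) \<and> e = (\<Sum>s<(n::nat). u s * v s)"
    if "i < m" for i
  proof (rule subspace_prod_expansion)
    have "subspace_prod scale (?G i) (?G ((m - i) mod m)) = ?G ((i + (m - i) mod m) mod m)"
      using strong that m by (simp add: strongly_graded_def)
    also have "(i + (m - i) mod m) mod m = 0"
      using that by (simp add: mod_add_right_eq)
    finally show "e \<in> subspace_prod scale (?G i) (?G ((m - i) mod m))"
      by (simp add: G0 aut(4))
    show "scale c a \<in> ?G i" if "a \<in> ?G i" for c a
      using that by (simp add: eigen_component_def lin_scale[OF aut(1)] mult.commute)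
  qed
  then have "\<forall>i. \<exists>n u v. i < m \<longrightarrow>
      (\<forall>s<n. u s \<in> ?G i \<and> v s \<in> ?G ((m - i) mod m)) \<and> e = (\<Sum>s<(n::nat). u s * v s)"
    by blast
  then obtain n u v where *: "\<forall>i. i < m \<longrightarrow>
      (\<forall>s<n i. u i s \<in> ?G i \<and> v i s \<in> ?G ((m - i) mod m)) \<and> e = (\<Sum>s<(n i::nat). u i s * v i s)"
    unfolding choice_iff by blast
  then have uv: "\<And>i s. i < m \<Longrightarrow> s < n i \<Longrightarrow> u i s \<in> ?G i \<and> v i s \<in> ?G ((m - i) mod m)"
    and e: "\<And>i. i < m \<Longrightarrow> (\<Sum>s<(n i::nat). u i s * v i s) = e"
    by auto
  have \<rho>u: "\<rho> (u i s) = scale (w ^ i) (u i s)" if "i < m" "s < n i" for i s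
    using uv[OF that] by (simp add: eigen_component_def)
  have \<rho>v: "\<rho> (v i s) = scale (inverse w ^ i) (v i s)" if "i < m" "s < n i" for i s
  proof -
    have "w ^ ((m - i) mod m) * w ^ i = 1"
      using that(1) wm by (cases "i = 0") (simp_all flip: power_add)
    then have "w ^ ((m - i) mod m) = inverse w ^ i"
      using w_nonzero by (simp add: field_simps)
    then show ?thesis
      using uv[OF that] by (simp add: eigen_component_def)
  qed
  define T where "T = (SIGMA i:{..<m}. {..<n i})"
  define u' where "u' = (\<lambda>(i, s). u i s)"
  define v' where "v' = (\<lambda>(i, s). v i s)"
  have sum_T: "(\<Sum>t\<in>T. F (u' t) (v' t)) = (\<Sum>i<m. \<Sum>s<n i. F (u i s) (v i s))" for F :: "'a \<Rightarrow> 'a \<Rightarrow> 'a"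
    by (simp add: T_def u'_def v'_def sum.Sigma case_prod_unfold)
  have "separable_frobenius_extension scale e (?G 0) (average \<rho> m) T u' v' (of_nat m)"
  proof
    show "subspace (?G 0)"
      by (simp add: subspace_def G0 lin_add[OF aut(1)] lin_scale[OF aut(1)] lin_zero[OF aut(1)])
    show "a * b \<in> ?G 0" if "a \<in> ?G 0" "b \<in> ?G 0" for a b
      using that by (simp add: G0 aut(3))
    show "e \<in> ?G 0" by (simp add: G0 aut(4))
    show "average \<rho> m x \<in> ?G 0" for x
      using sum_cyclic_shift[of "\<lambda>j. (\<rho> ^^ j) x" m] order
      by (simp add: G0 average_def lin_scale[OF aut(1)] lin_sum[OF aut(1)])
    show "lin (average \<rho> m)"
      by (rule linI)
         (simp_all add: average_def lin_add[OF pow(1)] lin_scale[OF pow(1)] sum.distrib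
            scale_right_distrib scale_sum_right mult.commute)
    have fixed: "(\<rho> ^^ j) a = a" if "\<rho> a = a" for j a
      using that by (induction j) simp_all
    show "average \<rho> m (a * x) = a * average \<rho> m x" if "a \<in> ?G 0" for a x
      using fixed[of a] that
      by (simp add: average_def pow(2) G0 scale_mult_right sum_distrib_left)
    show "average \<rho> m e = e"
      using scale_average_constant[OF m0, of e] by (simp add: average_def fixed[OF aut(4)])
    show "(\<Sum>t\<in>T. average \<rho> m (x * u' t) * v' t) = x" for x
    proof -
      have "(\<Sum>t\<in>T. average \<rho> m (x * u' t) * v' t) = (\<Sum>i<m. \<Sum>s<n i. average \<rho> m (x * u i s) * v i s)"
        by (rule sum_T)
      also have "\<dots> = (\<Sum>i<m. scale (inverse (of_nat m)) (\<Sum>j<m. scale ((w ^ i) ^ j) ((\<rho> ^^ j) x)))"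
        using \<rho>u e by (intro sum.cong refl average_dual_left[OF \<rho>]) auto
      also have "\<dots> = x"
        using character_sum[OF w, of "\<lambda>j. (\<rho> ^^ j) x"] by simp
      finally show ?thesis .
    qed
    show "(\<Sum>t\<in>T. u' t * average \<rho> m (v' t * x)) = x" for x
    proof -
      have "(\<Sum>t\<in>T. u' t * average \<rho> m (v' t * x)) = (\<Sum>i<m. \<Sum>s<n i. u i s * average \<rho> m (v i s * x))"
        by (rule sum_T)
      also have "\<dots> =
          (\<Sum>i<m. scale (inverse (of_nat m)) (\<Sum>j<m. scale ((inverse w ^ i) ^ j) ((\<rho> ^^ j) x)))"
        using \<rho>v e by (intro sum.cong refl average_dual_right[OF \<rho>]) auto
      also have "\<dots> = x"
        using character_sum[OF primitive_root_inverse[OF w], of "\<lambda>j. (\<rho> ^^ j) x"] by simp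
      finally show ?thesis .
    qed
    have "(\<Sum>t\<in>T. u' t * v' t) = (\<Sum>i<m. e)"
      unfolding sum_T by (simp add: e)
    also have "\<dots> = scale (of_nat m) (scale (inverse (of_nat m)) (\<Sum>i<m. e))"
      using m0 by simp
    finally show "(\<Sum>t\<in>T. u' t * v' t) = scale (of_nat m) e"
      by (simp only: scale_average_constant[OF m0])
    show "of_nat m \<noteq> (0 :: 'k)" by (rule m0)
  qed
  then show ?thesis by blast
qed

end

theorem mainTheorem3:
  fixes scale :: "'k::field \<Rightarrow> 'a::ring \<Rightarrow> 'a"
    and e :: 'a and \<phi> :: "'a \<Rightarrow> 'k" and \<rho> :: "'a \<Rightarrow> 'a" and m :: nat and w :: 'k
  assumes "fd_algebra scale e"
    and "frobenius_homomorphism scale \<phi>"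
    and "nakayama_automorphism scale e \<phi> \<rho>"
    and "has_order \<rho> m"
    and "primitive_root_of_unity m w"
    and "strongly_graded scale m (eigen_component scale \<rho> w)"
    and "HH2_vanishes scale (eigen_component scale \<rho> w 0)"
  shows "rigid scale"
proof -
  interpret fd_algebra scale e by fact
  let ?S = "eigen_component scale \<rho> w 0"
  have \<rho>: "algebra_automorphism scale e \<rho>"
    using assms(3) by (simp add: nakayama_automorphism_def)
  have order: "\<rho> ^^ m = id"
    using assms(4) by (simp add: has_order_def)
  obtain T :: "(nat \<times> nat) set" and u v where
    "separable_frobenius_extension scale e ?S (average \<rho> m) T u v (of_nat m)"
    using strongly_graded_separable_frobenius[OF \<rho> order assms(5,6)] by blast
  then interpret ext: separable_frobenius_extension scale e ?S "average \<rho> m" T u v "of_nat m" .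
  have "f \<in> coboundaries2 scale UNIV" if f: "f \<in> cocycles2 scale UNIV" for f
  proof -
    obtain h where h: "h \<in> cocycles2 scale UNIV" "(\<lambda>x y. f x y - h x y) \<in> coboundaries2 scale UNIV"
      "\<And>x y. h (\<rho> x) (\<rho> y) = \<rho> (h x y)"
      using invariant_representative[OF assms(2,3) order primitive_root_of_nat_nonzero[OF assms(5)] f]
      by blast
    have "h a b \<in> ?S" if "a \<in> ?S" "b \<in> ?S" for a b
      using that h(3)[of a b] by (simp add: eigen_component_def)
    then have "h \<in> coboundaries2 scale UNIV"
      by (rule ext.coboundary_if_HH2_vanishes[OF assms(7) h(1)])
    with h(2) show ?thesis by (rule cohomologous_coboundary)
  qed
  then show ?thesis
    by (intro rigid_if_cocycles_coboundaries subsetI)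
qed

end
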